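(* Let $\mathbb{K}$ be a field of characteristic zero, $\lambda$ a positive integer, and $d\in\mathbb{K}[x,y,z]$ an irreducible polynomial such that (a) there exist a positive integer $m$ and integers $n,k$ with $\sigma_x^m(d)=\sigma_y^n\sigma_z^k(d)$, and (b) there exist integers $n_1,k_1$ with $n_1>0$ and $\sigma_y^{n_1}(d)=\sigma_z^{k_1}(d)$. Let $$r=\sum_{i=1}^I\sum_{\ell=1}^{m_i}\frac{b_{i,\ell}}{c_i^\ell d^\lambda},$$ where $b_{i,\ell}\in\mathbb{K}[x,y,z]$ with $\deg_z(b_{i,\ell})<\deg_z(d)$, the $c_i\in\mathbb{K}[x,y]$ are pairwise distinct irreducible polynomials with $\deg_y(b_{i,\ell})<\deg_y(c_i)$, and for each $i$ there are no integers $n_i',k_i'$ with $n_i'>0$ and $\sigma_x^{n_i'}(c_i)=\sigma_y^{k_i'}(c_i)$. For each $\ell\ge1$ set $r_\ell=\sum_{i=1}^I\frac{b_{i,\ell}}{c_i^\ell d^\lambda}$, where $b_{i,\ell}:=0$ if $\ell>m_i$. Then $r$ has a telescoper if and only if $r_\ell$ is $(\sigma_y,\sigma_z)$-summable for every $\ell$.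
   Context: $\sigma_x,\sigma_y,\sigma_z$ are the shift automorphisms of $\mathbb{K}(x,y,z)$: $\sigma_x(f)=f(x+1,y,z)$, $\sigma_y(f)=f(x,y+1,z)$, $\sigma_z(f)=f(x,y,z+1)$. A rational function $g\in\mathbb{K}(x,y,z)$ is $(\sigma_y,\sigma_z)$-summable if $g=\sigma_y(u)-u+\sigma_z(v)-v$ for some $u,v\in\mathbb{K}(x,y,z)$. A telescoper for $f$ is a nonzero operator $L=\sum_i \ell_i S_x^i$ with $\ell_i\in\mathbb{K}(x)$ such that $L(f)=\sum_i\ell_i f(x+i,y,z)$ is $(\sigma_y,\sigma_z)$-summable. *)

theory Defs
  imports "HOL-Computational_Algebra.Polynomial" "HOL-Computational_Algebra.Fraction_Field"
begin

text \<open>Conventions. K[x] = 'k poly; K[x,y] = 'k poly poly (outer variable y, coefficients in K[x]);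
K[x,y,z] = 'k poly poly poly (outer variable z, coefficients in K[x,y]);
K(x,y,z) = fraction field ('k poly poly poly) fract.\<close>

type_synonym 'k pxy = "'k poly poly"
type_synonym 'k pxyz = "'k poly poly poly"
type_synonym 'k rxyz = "'k poly poly poly fract"

definition shx2 :: "int \<Rightarrow> 'k::field_char_0 pxy \<Rightarrow> 'k pxy" where
  "shx2 n c = map_poly (\<lambda>s. pcompose s [:of_int n, 1:]) c"

definition shy2 :: "int \<Rightarrow> 'k::field_char_0 pxy \<Rightarrow> 'k pxy" where
  "shy2 n c = pcompose c [:[:of_int n:], 1:]"

definition shx :: "int \<Rightarrow> 'k::field_char_0 pxyz \<Rightarrow> 'k pxyz" where
  "shx n p = map_poly (shx2 n) p"

definition shy :: "int \<Rightarrow> 'k::field_char_0 pxyz \<Rightarrow> 'k pxyz" where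
  "shy n p = map_poly (shy2 n) p"

definition shz :: "int \<Rightarrow> 'k::field_char_0 pxyz \<Rightarrow> 'k pxyz" where
  "shz n p = pcompose p [:[:[:of_int n:]:], 1:]"

definition fr_map :: "('a::idom \<Rightarrow> 'a) \<Rightarrow> 'a fract \<Rightarrow> 'a fract" where
  "fr_map f u = (let p = (SOME p. snd p \<noteq> 0 \<and> u = Fract (fst p) (snd p))
                 in Fract (f (fst p)) (f (snd p)))"

definition sigx :: "int \<Rightarrow> 'k::field_char_0 rxyz \<Rightarrow> 'k rxyz" where
  "sigx n = fr_map (shx n)"
definition sigy :: "int \<Rightarrow> 'k::field_char_0 rxyz \<Rightarrow> 'k rxyz" where
  "sigy n = fr_map (shy n)"
definition sigz :: "int \<Rightarrow> 'k::field_char_0 rxyz \<Rightarrow> 'k rxyz" where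
  "sigz n = fr_map (shz n)"

definition yz_summable :: "'k::field_char_0 rxyz \<Rightarrow> bool" where
  "yz_summable g \<longleftrightarrow> (\<exists>u v. g = sigy 1 u - u + sigz 1 v - v)"

definition Kx :: "'k::field_char_0 rxyz set" where
  "Kx = {Fract [:[:p:]:] [:[:q:]:] | p q. q \<noteq> 0}"

definition has_telescoper :: "'k::field_char_0 rxyz \<Rightarrow> bool" where
  "has_telescoper f \<longleftrightarrow> (\<exists>N (l :: nat \<Rightarrow> 'k rxyz).
      (\<forall>i\<le>N. l i \<in> Kx) \<and> (\<exists>i\<le>N. l i \<noteq> 0) \<and>
      yz_summable (\<Sum>i\<le>N. l i * sigx (int i) f))"

definition degy :: "'k::field_char_0 pxyz \<Rightarrow> nat" where
  "degy p = Max ((\<lambda>j. degree (coeff p j)) ` {..degree p})"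

end

theory Submission
  imports Defs "Berlekamp_Zassenhaus.Unique_Factorization_Poly"
begin

text \<open>Expand an element of \<open>K(x,y,z)\<close> into partial fractions in \<open>z\<close> over \<open>K(x,y)\<close>, and every
  coefficient of a numerator into partial fractions in \<open>y\<close> over \<open>K(x)\<close>. This grades \<open>K(x,y,z)\<close>
  over \<open>K(x)\<close> by pairs \<open>(c, \<ell>)\<close>, with \<open>c\<close> monic irreducible in \<open>K(x)[y]\<close>; \<open>\<sigma>\<^sub>x\<close> and \<open>\<sigma>\<^sub>y\<close> permute
  the components through their action on \<open>c\<close> and \<open>\<sigma>\<^sub>z\<close> preserves each of them. Hence the part of
  a summable function supported on a \<open>\<sigma>\<^sub>y\<close>-invariant set of pairs is again summable.
  Since \<open>d\<close> and \<open>d(y + n\<^sub>1)\<close> differ by a shift in \<open>z\<close>, the leading coefficient of \<open>d\<close> in \<open>z\<close> lies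
  in \<open>K[x]\<close>, so each \<open>b / (c\<^sub>i ^ \<ell> d ^ \<lambda>)\<close> lies in the single component \<open>(c\<^sub>i, \<ell>)\<close> up to normalising
  \<open>c\<^sub>i\<close>. By hypothesis no positive power of \<open>\<sigma>\<^sub>x\<close> maps \<open>c\<^sub>i\<close> into its own \<open>\<sigma>\<^sub>y\<close>-orbit, so some orbit
  in the support of \<open>r\<close> has no positive \<open>\<sigma>\<^sub>x\<close>-shift in the support. The leading
  term of a telescoper moves the part of \<open>r\<close> on that orbit to a place that no other term reaches, so
  that part is summable. Removing it and iterating, \<open>r\<close> itself is summable, and so is its part
  \<open>r\<^sub>\<ell>\<close> of exponent \<open>\<ell>\<close>.\<close>

subsection \<open>Lifting homomorphisms to fraction fields\<close>

text \<open>Source and target ring may differ, as \<open>const_fract\<close> requires; on a single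
  ring this is \<open>fr_map\<close>. The choice of representative is harmless once \<open>f\<close>
  is an injective homomorphism.\<close>

definition fract_lift :: "('a::idom \<Rightarrow> 'b::idom) \<Rightarrow> 'a fract \<Rightarrow> 'b fract" where
  "fract_lift f u = (let p = (SOME p. snd p \<noteq> 0 \<and> u = Fract (fst p) (snd p))
                     in Fract (f (fst p)) (f (snd p)))"

lemma fr_map_eq_fract_lift: "fr_map f = fract_lift f"
  by (simp add: fun_eq_iff fr_map_def fract_lift_def)

text \<open>Injectivity keeps denominators nonzero, so equality of cross products survives whichever
  representative \<open>SOME\<close> returns.\<close>

lemma fract_lift_Fract:
  assumes "inj_idom_hom f"
  shows "fract_lift f (Fract a b) = Fract (f a) (f b)"
proof -
  interpret inj_idom_hom f by fact
  have main: "fract_lift f (Fract a b) = Fract (f a) (f b)" if "b \<noteq> 0" for a b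
  proof -
    define p where "p = (SOME p. snd p \<noteq> 0 \<and> Fract a b = Fract (fst p) (snd p))"
    have "snd p \<noteq> 0 \<and> Fract a b = Fract (fst p) (snd p)"
      unfolding p_def by (rule someI[of _ "(a, b)"]) (use that in simp)
    then have "snd p \<noteq> 0" "a * snd p = fst p * b"
      using that by (auto simp: eq_fract)
    then have "f (a * snd p) = f (fst p * b)" "snd p \<noteq> 0"
      by simp_all
    then have "Fract (f (fst p)) (f (snd p)) = Fract (f a) (f b)"
      using that by (auto simp: eq_fract hom_distribs)
    then show ?thesis
      by (simp add: fract_lift_def p_def)
  qed
  \<comment> \<open>\<open>Fract a 0\<close> is the zero fraction, so a zero denominator reduces to
    the case of \<open>Fract 0 1\<close>.\<close>
  show ?thesis
    using main[of b a] main[of 1 0] by (cases "b = 0") (simp_all add: eq_fract)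
qed

lemma fract_lift_to_fract:
  assumes "inj_idom_hom f"
  shows "fract_lift f (to_fract a) = to_fract (f a)"
proof -
  interpret inj_idom_hom f by fact
  show ?thesis
    by (simp add: to_fract_def fract_lift_Fract[OF assms])
qed

lemma field_hom_fract_lift:
  assumes "inj_idom_hom f"
  shows "field_hom (fract_lift f)"
proof -
  interpret inj_idom_hom f by fact
  note [simp] = fract_lift_Fract[OF assms]
  show ?thesis
  proof
    fix x y :: "'a fract"
    show "fract_lift f 0 = 0" "fract_lift f 1 = 1"
      by (simp_all add: Zero_fract_def One_fract_def)
    obtain a b where x: "x = Fract a b" "b \<noteq> 0" by (cases x) auto
    obtain c d where y: "y = Fract c d" "d \<noteq> 0" by (cases y) auto
    show "fract_lift f (x + y) = fract_lift f x + fract_lift f y"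
      "fract_lift f (x * y) = fract_lift f x * fract_lift f y"
      using x y by (simp_all add: hom_distribs)
  qed
qed

lemma fract_lift_comp:
  assumes "inj_idom_hom f" "inj_idom_hom g"
  shows "fract_lift f (fract_lift g u) = fract_lift (\<lambda>a. f (g a)) u"
proof -
  interpret f: inj_idom_hom f by fact
  interpret g: inj_idom_hom g by fact
  have "inj_idom_hom (\<lambda>a. f (g a))"
    by standard (simp_all add: hom_distribs)
  then show ?thesis
    using assms by (cases u) (simp add: fract_lift_Fract)
qed

lemma fract_lift_id: "fract_lift (\<lambda>a. a) u = u"
proof -
  have "inj_idom_hom (\<lambda>a::'a. a)" by standard simp_all
  then show ?thesis by (cases u) (simp add: fract_lift_Fract)
qed

lemma field_isom_fract_lift:
  assumes "idom_isom f"
  shows "field_isom (fract_lift f)"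
proof -
  interpret idom_isom f by fact
  have f: "inj_idom_hom f" ..
  interpret l: field_hom "fract_lift f" by (rule field_hom_fract_lift[OF f])
  show ?thesis
  proof
    have "\<exists>v. u = fract_lift f v" for u
    proof (cases u)
      case (Fract a b)
      obtain a' b' where "a = f a'" "b = f b'"
        using surj by (meson surjD)
      then show ?thesis
        using Fract by (intro exI[of _ "Fract a' b'"]) (simp add: fract_lift_Fract[OF f])
    qed
    then show "surj (fract_lift f)" by (auto simp: surj_def)
  qed
qed

subsection \<open>Fractions of polynomials over a fraction field\<close>

definition const_fract :: "'a::idom fract \<Rightarrow> 'a poly fract" where
  "const_fract = fract_lift (\<lambda>a. [:a:])"

lemma inj_idom_hom_pCons_const: "inj_idom_hom (\<lambda>a::'a::idom. [:a:])"
  by standard (simp_all add: one_pCons)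

interpretation const_fract: field_hom "const_fract :: 'a::idom fract \<Rightarrow> _"
  unfolding const_fract_def by (rule field_hom_fract_lift[OF inj_idom_hom_pCons_const])

lemma const_fract_to_fract: "const_fract (to_fract a) = to_fract [:a:]"
  by (simp add: const_fract_def fract_lift_to_fract[OF inj_idom_hom_pCons_const])

text \<open>The embedding of Frac(R)[X] into Frac(R[X]), with X evaluated at itself. It presents
  elements of Frac(R[X]) as quotients of polynomials over a field, where division with remainder and
  Bezout relations exist. It is used for R = K[x], X = y and for R = K[x,y], X = z.\<close>

definition fract_eval :: "'a::idom fract poly \<Rightarrow> 'a poly fract" where
  "fract_eval p = poly (map_poly const_fract p) (to_fract [:0, 1:])"

lemma fract_eval_pCons:
  "fract_eval (pCons a p) = const_fract a + to_fract [:0, 1:] * fract_eval p"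
  by (simp add: fract_eval_def hom_distribs)

lemma fract_eval_fract_poly: "fract_eval (map_poly to_fract p) = to_fract p"
proof (induction p)
  case (pCons a p)
  have "to_fract (pCons a p) = to_fract ([:a:] + [:0, 1:] * p)" by simp
  also have "\<dots> = to_fract [:a:] + to_fract [:0, 1:] * to_fract p"
    by (simp only: to_fract_add to_fract_mult)
  finally show ?case
    using pCons by (simp add: map_poly_pCons fract_eval_pCons const_fract_to_fract)
qed (simp add: fract_eval_def)

lemma fract_poly_clear_denominators:
  fixes p :: "'a::idom fract poly"
  obtains a q where "a \<noteq> 0" "smult (to_fract a) p = map_poly to_fract q"
proof -
  have "\<exists>a q. a \<noteq> 0 \<and> smult (to_fract a) p = map_poly to_fract q"
  proof (induction p)
    case 0
    show ?case by (intro exI[of _ 1] exI[of _ 0]) simp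
  next
    case (pCons u p)
    then obtain a q where aq: "a \<noteq> 0" "smult (to_fract a) p = map_poly to_fract q" by auto
    obtain m n where u: "u = Fract m n" "n \<noteq> 0" by (cases u) auto
    have "smult (to_fract (a * n)) (pCons u p)
        = pCons (to_fract (a * m)) (smult (to_fract n) (smult (to_fract a) p))"
      using u by (simp add: Fract_conv_to_fract mult.commute)
    also have "\<dots> = map_poly to_fract (pCons (a * m) (smult n q))"
      by (simp add: aq to_fract_hom.map_poly_pCons_hom)
    finally show ?case
      using aq u by (intro exI[of _ "a * n"]) auto
  qed
  then show ?thesis using that by blast
qed

interpretation fract_eval: inj_idom_hom "fract_eval :: 'a::idom fract poly \<Rightarrow> _"
proof -
  interpret c: map_poly_idom_hom "const_fract :: 'a fract \<Rightarrow> _" ..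
  show "inj_idom_hom (fract_eval :: 'a fract poly \<Rightarrow> _)"
  proof
    fix p q :: "'a fract poly"
    show "fract_eval (0 :: 'a fract poly) = 0" "fract_eval (1 :: 'a fract poly) = 1"
      by (simp_all add: fract_eval_def)
    show "fract_eval (p + q) = fract_eval p + fract_eval q"
      "fract_eval (p * q) = fract_eval p * fract_eval q"
      by (simp_all add: fract_eval_def hom_distribs)
  next
    \<comment> \<open>Injectivity: after multiplication by a common denominator the value is an
      element of R[X] inside its own fraction field.\<close>
    fix p :: "'a fract poly"
    assume p: "fract_eval p = 0"
    obtain a q where aq: "a \<noteq> 0" "smult (to_fract a) p = map_poly to_fract q"
      by (rule fract_poly_clear_denominators)
    have "fract_eval ([:to_fract a:] * p) = 0"
      using p by (simp add: fract_eval_def hom_distribs)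
    then have "to_fract q = 0"
      using aq by (simp add: fract_eval_fract_poly)
    then show "p = 0"
      using aq by simp
  qed
qed

lemma fract_eval_const: "fract_eval [:u:] = const_fract u"
  by (simp add: fract_eval_pCons)

lemma fract_eval_surj:
  obtains a b where "b \<noteq> 0" "v = fract_eval a / fract_eval b"
proof (cases v)
  case (Fract a b)
  then show ?thesis
    using that[of "map_poly to_fract b" "map_poly to_fract a"]
    by (simp add: fract_eval_fract_poly Fract_conv_to_fract)
qed

subsection \<open>Partial fractions\<close>

text \<open>The index \<open>d = 1\<close>, \<open>j = 0\<close> stands for the polynomial part.\<close>

definition pf_digit :: "'a::idom fract poly \<Rightarrow> nat \<Rightarrow> 'a fract poly \<Rightarrow> bool" where
  "pf_digit d j b \<longleftrightarrow> j = 0 \<and> d = 1 \<or>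
     j > 0 \<and> irreducible d \<and> lead_coeff d = 1 \<and> degree b < degree d"

text \<open>\<open>Q\<close> restricts the numerators allowed over each power; different choices of
  \<open>Q\<close> give the pieces of the grading. The same pair \<open>(d, j)\<close> may be added
  repeatedly; collecting terms is left to \<open>pf_space_representation\<close>.\<close>

inductive_set pf_space ::
    "('a::idom fract poly \<Rightarrow> nat \<Rightarrow> 'a fract poly set) \<Rightarrow> 'a poly fract set"
  for Q where
  zero: "0 \<in> pf_space Q"
| add: "\<lbrakk>v \<in> pf_space Q; pf_digit d j b; b \<in> Q d j\<rbrakk>
    \<Longrightarrow> v + fract_eval b / fract_eval d ^ j \<in> pf_space Q"

lemma pf_space_digit:
  "\<lbrakk>pf_digit d j b; b \<in> Q d j\<rbrakk> \<Longrightarrow> fract_eval b / fract_eval d ^ j \<in> pf_space Q"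
  using pf_space.add[OF pf_space.zero, of d j b Q] by simp

lemma pf_space_add:
  assumes "u \<in> pf_space Q" "v \<in> pf_space Q"
  shows "u + v \<in> pf_space Q"
  using assms(2)
proof induction
  case zero
  then show ?case using assms(1) by simp
next
  case (add v d j b)
  then show ?case
    using pf_space.add[of "u + v" Q d j b] by (simp add: add.assoc)
qed

lemma pf_space_image:
  assumes "v \<in> pf_space Q"
    and "\<And>u w. f (u + w) = f u + f w" "f 0 = 0"
    and "\<And>d j b. pf_digit d j b \<Longrightarrow> b \<in> Q d j \<Longrightarrow>
      f (fract_eval b / fract_eval d ^ j) \<in> pf_space Q'"
  shows "f v \<in> pf_space Q'"
  using assms(1) by induction (auto simp: assms(2-4) pf_space.zero intro: pf_space_add)

lemma pf_space_mono:
  assumes "v \<in> pf_space Q" "\<And>d j. Q d j \<subseteq> Q' d j"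
  shows "v \<in> pf_space Q'"
  using assms(1) by induction (use assms(2) in \<open>auto intro: pf_space.intros\<close>)

lemma pf_digit_uminus: "pf_digit d j (- b) \<longleftrightarrow> pf_digit d j b"
  by (simp add: pf_digit_def)

lemma pf_space_uminus:
  assumes "v \<in> pf_space Q" "\<And>d j b. b \<in> Q d j \<Longrightarrow> - b \<in> Q d j"
  shows "- v \<in> pf_space Q"
proof (rule pf_space_image[OF assms(1)])
  fix d j b assume "pf_digit d j b" "b \<in> Q d j"
  then show "- (fract_eval b / fract_eval d ^ j) \<in> pf_space Q"
    using pf_space_digit[of d j "- b" Q] assms(2) by (simp add: pf_digit_uminus hom_distribs)
qed simp_all

lemma pf_space_scale:
  assumes "v \<in> pf_space Q" "\<And>d j b. b \<in> Q d j \<Longrightarrow> smult u b \<in> Q d j"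
  shows "const_fract u * v \<in> pf_space Q"
proof (rule pf_space_image[OF assms(1)])
  fix d j b assume db: "pf_digit d j b" "b \<in> Q d j"
  have "const_fract u * fract_eval b = fract_eval ([:u:] * b)"
    by (simp only: fract_eval_const fract_eval.hom_mult)
  moreover have "pf_digit d j (smult u b)"
    using db(1) unfolding pf_digit_def by (auto intro: le_less_trans[OF degree_smult_le])
  ultimately show "const_fract u * (fract_eval b / fract_eval d ^ j) \<in> pf_space Q"
    using pf_space_digit[of d j "smult u b" Q] assms(2) db by simp
qed (simp_all add: distrib_left)

section \<open>Existence of partial fraction expansions\<close>

lemma irreducible_bezout:
  fixes c q :: "'a::field_gcd poly"
  assumes "irreducible c" "\<not> c dvd q"
  obtains s t where "s * c + t * q = 1"
proof -
  have "gcd c q dvd c" by simp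
  then obtain e where e: "c = gcd c q * e" ..
  have "gcd c q dvd 1"
  proof (rule ccontr)
    assume "\<not> gcd c q dvd 1"
    then have "e dvd 1"
      using irreducibleD[OF assms(1) e] by blast
    then have "c dvd gcd c q"
      using e by (metis dvd_refl mult_unit_dvd_iff)
    then show False
      using assms(2) by (meson dvd_trans gcd_dvd2)
  qed
  then have "gcd c q = 1"
    by (metis is_unit_gcd_iff)
  then show ?thesis
    using that bezout_coefficients_fst_snd[of c q] by metis
qed

lemma pf_space_UNIV_poly: "fract_eval a \<in> pf_space (\<lambda>_ _. UNIV)"
  using pf_space_digit[of 1 0 a "\<lambda>_ _. UNIV"] by (simp add: pf_digit_def)

text \<open>The expansion in powers of \<open>c\<close>: the remainder of \<open>a\<close> modulo
  \<open>c\<close> is the digit at the highest power, and the quotient continues over the next lower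
  power.\<close>

lemma pf_space_UNIV_prime_power:
  assumes c: "irreducible c" "lead_coeff c = 1"
  shows "fract_eval a / fract_eval c ^ n \<in> pf_space (\<lambda>_ _. UNIV)"
proof (induction n arbitrary: a)
  case 0
  then show ?case by (simp add: pf_space_UNIV_poly)
next
  case (Suc n)
  have c0: "c \<noteq> 0" "degree c > 0"
    using c(1) irreducible_degree_field by auto
  have "a = a div c * c + a mod c" by simp
  then have "fract_eval a = fract_eval (a div c) * fract_eval c + fract_eval (a mod c)"
    by (metis fract_eval.hom_add fract_eval.hom_mult)
  then have "fract_eval a / fract_eval c ^ Suc n = fract_eval (a div c) / fract_eval c ^ n
      + fract_eval (a mod c) / fract_eval c ^ Suc n"
    using c0 by (simp add: field_simps)
  moreover have "pf_digit c (Suc n) (a mod c)"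
    using c c0 degree_mod_less[of c a] by (auto simp: pf_digit_def)
  ultimately show ?case
    using pf_space_add[OF Suc pf_space_digit[of c "Suc n" "a mod c"]] by simp
qed

lemma exists_monic_irreducible_factor:
  fixes q :: "'a::field poly"
  assumes "degree q > 0"
  obtains c where "irreducible c" "lead_coeff c = 1" "c dvd q"
proof -
  have "\<exists>c. irreducible c \<and> lead_coeff c = 1 \<and> c dvd q"
    using assms
  proof (induction "degree q" arbitrary: q rule: less_induct)
    case less
    show ?case
    proof (cases "irreducible q")
      case True
      define c where "c = smult (inverse (lead_coeff q)) q"
      have q0: "q \<noteq> 0" using less.prems by auto
      have "irreducible c"
        using True q0 by (simp add: c_def irreducible_smult_field)
      moreover have "lead_coeff c = 1" "c dvd q"
        using q0 by (simp_all add: c_def smult_dvd_iff)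
      ultimately show ?thesis by blast
    next
      case False
      have q: "q \<noteq> 0" "\<not> q dvd 1"
        using less.prems by (auto simp: is_unit_iff_degree)
      with False obtain a b where ab: "q = a * b" "\<not> a dvd 1" "\<not> b dvd 1"
        by (auto simp: irreducible_def)
      then have nz: "a \<noteq> 0" "b \<noteq> 0" using q by auto
      then have "degree a > 0" "degree b > 0"
        using ab by (auto simp: is_unit_iff_degree)
      moreover from this have "degree a < degree q"
        using ab nz by (simp add: degree_mult_eq)
      ultimately show ?thesis
        using less.hyps[of a] ab(1) by (meson dvd_mult2)
    qed
  qed
  then show ?thesis using that by blast
qed

text \<open>Strong induction on the degree of the denominator: the full power of one monic
  irreducible factor is split off by a Bezout relation, and the cofactor has smaller degree.\<close>

lemma pf_space_UNIV: "v \<in> pf_space (\<lambda>_ _. UNIV)"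
proof -
  have "fract_eval a / fract_eval q \<in> pf_space (\<lambda>_ _. UNIV)" if "q \<noteq> 0" for a q :: "'a fract poly"
    using that
  proof (induction "degree q" arbitrary: a q rule: less_induct)
    case less
    show ?case
    proof (cases "degree q = 0")
      case True
      then obtain u where u: "q = [:u:]" "u \<noteq> 0"
        using less.prems by (metis degree_eq_zeroE pCons_0_0)
      have "fract_eval a / fract_eval q = fract_eval (smult (inverse u) a)"
      proof -
        have "fract_eval (smult (inverse u) a) * fract_eval q = fract_eval a"
          using u by (simp add: fract_eval.hom_mult[symmetric])
        then show ?thesis using less.prems by (simp add: field_simps)
      qed
      then show ?thesis by (simp add: pf_space_UNIV_poly)
    next
      case False
      then obtain c where c: "irreducible c" "lead_coeff c = 1" "c dvd q"
        using exists_monic_irreducible_factor by blast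
      then have cu: "\<not> c dvd 1" "degree c > 0" "c \<noteq> 0"
        using irreducible_degree_field by (auto simp: irreducible_def)
      define n where "n = multiplicity c q"
      obtain q' where q': "q = c ^ n * q'" "\<not> c dvd q'"
        using multiplicity_decompose'[of q c] less.prems cu unfolding n_def by blast
      have n: "n > 0"
        using q' c(3) by (cases n) auto
      have "\<exists>s t. s * c ^ n + t * q' = 1"
      proof -
        obtain s t where st: "s * c + t * q' = 1"
          using irreducible_bezout[OF c(1) q'(2)] by blast
        have "\<exists>s t. s * c ^ n + t * q' = 1" for n
        proof (induction n)
          case 0
          show ?case by (intro exI[of _ 1] exI[of _ 0]) simp
        next
          case (Suc n)
          then obtain s' t' where "s' * c ^ n + t' * q' = 1" by blast
          \<comment> \<open>In the product of the relations for \<open>c ^ n\<close> and for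
            \<open>c\<close>, every term other than the one carrying \<open>c ^ Suc n\<close>
            contains \<open>q'\<close>.\<close>
          then have "(s' * c ^ n + t' * q') * (s * c + t * q') = 1"
            using st by simp
          then have "(s' * s) * c ^ Suc n + (s' * c ^ n * t + t' * (s * c + t * q')) * q' = 1"
            by (simp add: algebra_simps)
          then show ?case by blast
        qed
        then show ?thesis by blast
      qed
      then obtain s t where st: "s * c ^ n + t * q' = 1" by blast
      have q'0: "q' \<noteq> 0" using q' by auto
      have "degree q = n * degree c + degree q'"
        using q'0 cu q'(1) by (simp add: degree_mult_eq degree_power_eq)
      then have lt: "degree q' < degree q"
        using n cu by simp
      have "fract_eval (s * c ^ n + t * q') = 1" by (simp add: st)
      then have one: "fract_eval s * fract_eval c ^ n + fract_eval t * fract_eval q' = 1"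
        by (simp add: hom_distribs)
      have nz: "fract_eval c \<noteq> 0" "fract_eval q' \<noteq> 0"
        using cu q'0 by auto
      have "fract_eval a / fract_eval q
          = fract_eval a * (fract_eval s * fract_eval c ^ n + fract_eval t * fract_eval q')
            / (fract_eval c ^ n * fract_eval q')"
        unfolding one by (simp add: q'(1) hom_distribs)
      also have "\<dots> = fract_eval (a * s) / fract_eval q' + fract_eval (a * t) / fract_eval c ^ n"
        using nz by (simp add: field_simps hom_distribs)
      finally show ?thesis
        using pf_space_add[OF less.hyps[OF lt q'0] pf_space_UNIV_prime_power[OF c(1,2)]]
        by simp
    qed
  qed
  then show ?thesis by (metis fract_eval_surj)
qed

text \<open>By \<open>pf_space_UNIV\<close> every element is a sum of single terms, so a splitting
  of numerators extends additively to the whole field.\<close>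

lemma pf_space_split:
  assumes "\<And>d j b. pf_digit d j b \<Longrightarrow>
    \<exists>b1 b2. b = b1 + b2 \<and> b1 \<in> Q1 d j \<and> b2 \<in> Q2 d j \<and> pf_digit d j b1 \<and> pf_digit d j b2"
  obtains v1 v2 where "v = v1 + v2" "v1 \<in> pf_space Q1" "v2 \<in> pf_space Q2"
proof -
  have "\<exists>v1 v2. v = v1 + v2 \<and> v1 \<in> pf_space Q1 \<and> v2 \<in> pf_space Q2"
    using pf_space_UNIV[of v]
  proof induction
    case zero
    then show ?case by (intro exI[of _ 0]) (simp add: pf_space.zero)
  next
    case (add v d j b)
    then obtain v1 v2 where v: "v = v1 + v2" "v1 \<in> pf_space Q1" "v2 \<in> pf_space Q2" by blast
    obtain b1 b2 where "b = b1 + b2" "b1 \<in> Q1 d j" "b2 \<in> Q2 d j" "pf_digit d j b1" "pf_digit d j b2"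
      using assms[OF \<open>pf_digit d j b\<close>] by blast
    then show ?case
      using v by (intro exI[of _ "v1 + fract_eval b1 / fract_eval d ^ j"]
          exI[of _ "v2 + fract_eval b2 / fract_eval d ^ j"])
        (auto intro: pf_space.add simp: hom_distribs add_divide_distrib)
  qed
  then show ?thesis using that by blast
qed

section \<open>Uniqueness of partial fractions, by localisation at a prime\<close>

definition fract_local :: "'a::idom fract poly \<Rightarrow> 'a poly fract set" where
  "fract_local d = {fract_eval a / fract_eval q | a q. \<not> d dvd q}"

lemma fract_localI: "\<not> d dvd q \<Longrightarrow> fract_eval a / fract_eval q \<in> fract_local d"
  by (auto simp: fract_local_def)

lemma fract_local_poly: "\<not> d dvd 1 \<Longrightarrow> fract_eval a \<in> fract_local d"
  using fract_localI[of d 1 a] by simp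

text \<open>Irreducible polynomials over a field are prime, so denominators prime to
  \<open>d\<close> are closed under products; \<open>fract_local d\<close> is the localisation at
  \<open>d\<close>.\<close>

lemma fract_local_add:
  assumes d: "irreducible d" and uv: "u \<in> fract_local d" "v \<in> fract_local d"
  shows "u + v \<in> fract_local d"
proof -
  obtain a q a' q' where *: "u = fract_eval a / fract_eval q" "\<not> d dvd q"
    "v = fract_eval a' / fract_eval q'" "\<not> d dvd q'"
    using uv by (auto simp: fract_local_def)
  then have "q \<noteq> 0" "q' \<noteq> 0" by auto
  then have "u + v = fract_eval (a * q' + a' * q) / fract_eval (q * q')"
    using * by (simp add: hom_distribs field_simps)
  moreover have "\<not> d dvd q * q'"
    using * d prime_elem_dvd_multD[of d q q'] by auto
  ultimately show ?thesis by (simp add: fract_localI)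
qed

lemma fract_local_mult_poly: "v \<in> fract_local d \<Longrightarrow> fract_eval p * v \<in> fract_local d"
proof -
  assume "v \<in> fract_local d"
  then obtain a q where "v = fract_eval a / fract_eval q" "\<not> d dvd q"
    by (auto simp: fract_local_def)
  then show ?thesis
    using fract_localI[of d q "p * a"] by (simp add: hom_distribs)
qed

lemma fract_local_sum:
  assumes "irreducible d" "\<And>i. i \<in> A \<Longrightarrow> f i \<in> fract_local d"
  shows "(\<Sum>i\<in>A. f i) \<in> fract_local d"
proof -
  have "\<not> d dvd 1" using assms(1) by (auto simp: irreducible_def)
  then have "0 \<in> fract_local d" using fract_local_poly[of d 0] by simp
  then show ?thesis
    using assms(2) by (induction A rule: infinite_finite_induct)
      (auto intro: fract_local_add[OF assms(1)])
qed

lemma monic_irreducible_dvd_eq: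
  fixes c d :: "'a::field poly"
  assumes "irreducible c" "lead_coeff c = 1" "irreducible d" "lead_coeff d = 1" "d dvd c"
  shows "c = d"
proof -
  obtain e where e: "c = d * e" using assms(5) ..
  then have "e dvd 1"
    using irreducibleD[OF assms(1) e] assms(3) by (auto simp: irreducible_def)
  then obtain u where "e = [:u:]"
    using is_unit_polyE by blast
  then show ?thesis
    using e assms(2,4) by (cases "u = 0") auto
qed

text \<open>Multiplying by \<open>d ^ (j - 1)\<close>, where \<open>j\<close> is the highest exponent of \<open>d\<close> with a nonzero
  numerator \<open>b\<close>, makes every term but \<open>b / d\<close> lie in the local ring at \<open>d\<close>.\<close>

lemma pf_independent:
  assumes "finite A" and digit: "\<And>d j. (d, j) \<in> A \<Longrightarrow> pf_digit d j (D (d, j))"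
    and sum0: "(\<Sum>(d, j)\<in>A. fract_eval (D (d, j)) / fract_eval d ^ j) = 0"
    and "i \<in> A"
  shows "D i = 0"
proof (rule ccontr)
  assume "D i \<noteq> 0"
  define T where "T = (\<lambda>(d, j). fract_eval (D (d, j)) / fract_eval d ^ j)"
  define A' where "A' = {i \<in> A. D i \<noteq> 0}"
  have fin: "finite A'" using assms(1) by (simp add: A'_def)
  have sum': "(\<Sum>i\<in>A'. T i) = 0"
  proof -
    have "(\<Sum>i\<in>A'. T i) = (\<Sum>i\<in>A. T i)"
      using assms(1) by (intro sum.mono_neutral_left) (auto simp: A'_def T_def)
    then show ?thesis using sum0 by (simp add: T_def)
  qed
  \<comment> \<open>No nonzero term can have a positive exponent. What remains is at most the
    polynomial part, which the vanishing sum then kills.\<close>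
  have positive: "snd k = 0" if "k \<in> A'" for k
  proof (rule ccontr)
    assume k: "snd k \<noteq> 0"
    define d where "d = fst k"
    define J where "J = {j. (d, j) \<in> A'}"
    have "J = snd ` (A' \<inter> {d} \<times> UNIV)" by (force simp: J_def)
    then have finJ: "finite J" using fin by simp
    have kJ: "snd k \<in> J" using that by (simp add: J_def d_def)
    define j where "j = Max J"
    have jJ: "j \<in> J" using finJ kJ by (auto simp: j_def intro: Max_in)
    have jk: "j \<ge> snd k" using finJ kJ by (simp add: j_def)
    then have j0: "j > 0" using k by simp
    have jA: "(d, j) \<in> A'" using jJ by (simp add: J_def)
    define b where "b = D (d, j)"
    have "pf_digit d j b" "b \<noteq> 0"
      using digit jA by (auto simp: A'_def b_def)
    then have d: "irreducible d" "lead_coeff d = 1" "degree b < degree d"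
      using j0 by (auto simp: pf_digit_def)
    have du: "\<not> d dvd 1" "d \<noteq> 0" using d by (auto simp: irreducible_def)
    have others: "fract_eval (d ^ (j - 1)) * T i \<in> fract_local d" if "i \<in> A' - {(d, j)}" for i
    proof -
      obtain d' j' where i: "i = (d', j')" by (cases i)
      show ?thesis
      proof (cases "d' = d")
        case True
        then have "j' \<in> J" "j' \<noteq> j" using that i by (auto simp: J_def)
        moreover from this have "j' \<le> j" using finJ by (simp add: j_def)
        ultimately have "j' \<le> j - 1" by linarith
        then obtain m where m: "j - 1 = j' + m" by (metis le_Suc_ex)
        have "fract_eval (d ^ (j - 1)) * T i = fract_eval (d ^ m * D i)"
          using du unfolding m by (simp add: T_def i True hom_distribs power_add)
        then show ?thesis using fract_local_poly[OF du(1)] by simp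
      next
        case False
        have "pf_digit d' j' (D i)" using that i digit by (simp add: A'_def)
        then have "\<not> d dvd d' ^ j'"
          unfolding pf_digit_def
        proof
          assume "0 < j' \<and> irreducible d' \<and> monic d' \<and> degree (D i) < degree d'"
          then have "\<not> d dvd d'"
            using monic_irreducible_dvd_eq[of d' d] d False by auto
          then show ?thesis
            using d(1) prime_elem_dvd_power[of d d' j'] by auto
        qed (use du in auto)
        then have "T i \<in> fract_local d"
          using fract_localI[of d "d' ^ j'" "D i"] by (simp add: T_def i hom_distribs)
        then show ?thesis by (rule fract_local_mult_poly)
      qed
    qed
    have "T (d, j) + (\<Sum>i\<in>A' - {(d, j)}. T i) = 0"
      using sum.remove[OF fin jA, of T] sum' by simp
    then have "fract_eval (d ^ (j - 1)) * T (d, j)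
        = - (\<Sum>i\<in>A' - {(d, j)}. fract_eval (d ^ (j - 1)) * T i)"
      by (metis add_eq_0_iff2 mult_minus_right sum_distrib_left)
    moreover have "(\<Sum>i\<in>A' - {(d, j)}. fract_eval (d ^ (j - 1)) * T i) \<in> fract_local d"
      by (rule fract_local_sum[OF d(1) others])
    then have "fract_eval (- 1) * (\<Sum>i\<in>A' - {(d, j)}. fract_eval (d ^ (j - 1)) * T i)
        \<in> fract_local d"
      by (rule fract_local_mult_poly)
    ultimately have "fract_eval (d ^ (j - 1)) * T (d, j) \<in> fract_local d"
      by (simp only: fract_eval.hom_uminus fract_eval.hom_one mult_minus_left mult_1_left)
    moreover have "fract_eval (d ^ (j - 1)) * T (d, j) = fract_eval b / fract_eval d"
      using du j0 by (cases j) (simp_all add: T_def b_def hom_distribs)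
    ultimately obtain a q where aq: "fract_eval b / fract_eval d = fract_eval a / fract_eval q" "\<not> d dvd q"
      by (auto simp: fract_local_def)
    then have "q \<noteq> 0" by auto
    \<comment> \<open>Since \<open>b / d\<close> lies in the local ring at \<open>d\<close>,
      clearing denominators makes the prime \<open>d\<close> divide \<open>b * q\<close>, hence
      \<open>b\<close>, whose degree is too small.\<close>
    then have "fract_eval (b * q) = fract_eval (d * a)"
      using aq du by (simp add: hom_distribs field_simps)
    then have "d dvd b * q" by simp
    then have "d dvd b"
      using aq(2) d(1) prime_elem_dvd_multD[of d b q] by auto
    then show False
      using \<open>b \<noteq> 0\<close> d(3) by (meson dvd_imp_degree_le not_less)
  qed
  have "A' \<subseteq> {(1, 0)}"
  proof
    fix k assume k: "k \<in> A'"
    obtain d j where dj: "k = (d, j)" by (cases k)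
    then have "pf_digit d j (D k)" "j = 0"
      using k digit positive by (auto simp: A'_def)
    then show "k \<in> {(1, 0)}" using dj by (auto simp: pf_digit_def)
  qed
  moreover have "i \<in> A'" using \<open>i \<in> A\<close> \<open>D i \<noteq> 0\<close> by (simp add: A'_def)
  ultimately have "A' = {i}" "i = (1, 0)" by auto
  then have "fract_eval (D i) = 0"
    using sum' by (simp add: T_def)
  then show False using \<open>D i \<noteq> 0\<close> by simp
qed

text \<open>Terms over the same power are merged, which is why \<open>Q\<close> must be closed under
  addition. \<open>D\<close> vanishes outside \<open>A\<close> so that two representations can be
  compared on the union of their index sets.\<close>

lemma pf_space_representation:
  assumes "v \<in> pf_space Q"
    and "\<And>d j. 0 \<in> Q d j" "\<And>d j b b'. b \<in> Q d j \<Longrightarrow> b' \<in> Q d j \<Longrightarrow> b + b' \<in> Q d j"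
  obtains A D where "finite A" "\<And>d j. (d, j) \<in> A \<Longrightarrow> pf_digit d j (D (d, j))"
    "\<And>d j. D (d, j) \<in> Q d j" "\<And>i. i \<notin> A \<Longrightarrow> D i = 0"
    "v = (\<Sum>(d, j)\<in>A. fract_eval (D (d, j)) / fract_eval d ^ j)"
proof -
  have "\<exists>A D. finite A \<and> (\<forall>d j. (d, j) \<in> A \<longrightarrow> pf_digit d j (D (d, j)))
    \<and> (\<forall>d j. D (d, j) \<in> Q d j) \<and> (\<forall>i. i \<notin> A \<longrightarrow> D i = 0)
    \<and> v = (\<Sum>(d, j)\<in>A. fract_eval (D (d, j)) / fract_eval d ^ j)"
    using assms(1)
  proof induction
    case zero
    show ?case
      by (intro exI[of _ "{}"] exI[of _ "\<lambda>_. 0"]) (simp add: assms(2))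
  next
    case (add v d j b)
    then obtain A D where AD: "finite A" "\<And>d j. (d, j) \<in> A \<Longrightarrow> pf_digit d j (D (d, j))"
      "\<And>d j. D (d, j) \<in> Q d j" "\<And>i. i \<notin> A \<Longrightarrow> D i = 0"
      "v = (\<Sum>(d, j)\<in>A. fract_eval (D (d, j)) / fract_eval d ^ j)"
      by blast
    define B where "B = insert (d, j) A"
    define D' where "D' = D((d, j) := D (d, j) + b)"
    have "pf_digit d j (D (d, j) + b)"
    proof (cases "(d, j) \<in> A")
      case True
      then show ?thesis
        using AD(2)[OF True] add.hyps by (auto simp: pf_digit_def intro: degree_add_less)
    qed (use AD(4) add.hyps in simp)
    then have "\<forall>d j. (d, j) \<in> B \<longrightarrow> pf_digit d j (D' (d, j))"
      using AD(2) by (auto simp: B_def D'_def)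
    moreover have "\<forall>d j. D' (d, j) \<in> Q d j"
      using AD(3) add.hyps assms(3) by (auto simp: D'_def)
    moreover have "\<forall>i. i \<notin> B \<longrightarrow> D' i = 0"
      using AD(4) by (auto simp: B_def D'_def)
    moreover have "v + fract_eval b / fract_eval d ^ j
        = (\<Sum>(d, j)\<in>B. fract_eval (D' (d, j)) / fract_eval d ^ j)"
    proof -
      have v: "v = (\<Sum>(d, j)\<in>B. fract_eval (D (d, j)) / fract_eval d ^ j)"
        unfolding AD(5) using AD(1,4) by (intro sum.mono_neutral_left) (auto simp: B_def)
      \<comment> \<open>The new term is written as a sum over \<open>B\<close> concentrated at
        \<open>(d, j)\<close>, to be merged with the old sum index by index.\<close>
      have "v + fract_eval b / fract_eval d ^ j
          = (\<Sum>(d', j')\<in>B. fract_eval (D (d', j')) / fract_eval d' ^ j')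
            + (\<Sum>i\<in>B. if i = (d, j) then fract_eval b / fract_eval d ^ j else 0)"
        using AD(1) unfolding v by (simp add: B_def)
      also have "\<dots> = (\<Sum>(d, j)\<in>B. fract_eval (D' (d, j)) / fract_eval d ^ j)"
        unfolding sum.distrib[symmetric]
      proof (intro sum.cong refl)
        fix i assume "i \<in> B"
        show "(case i of (d', j') \<Rightarrow> fract_eval (D (d', j')) / fract_eval d' ^ j')
            + (if i = (d, j) then fract_eval b / fract_eval d ^ j else 0)
          = (case i of (d, j) \<Rightarrow> fract_eval (D' (d, j)) / fract_eval d ^ j)"
          by (cases "i = (d, j)")
            (auto simp: D'_def hom_distribs add_divide_distrib split: prod.split)
      qed
      finally show ?thesis .
    qed
    ultimately show ?case
      using AD(1) by (intro exI[of _ B] exI[of _ D']) (simp add: B_def)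
  qed
  then obtain A D where "finite A" "\<forall>d j. (d, j) \<in> A \<longrightarrow> pf_digit d j (D (d, j))"
    "\<forall>d j. D (d, j) \<in> Q d j" "\<forall>i. i \<notin> A \<longrightarrow> D i = 0"
    "v = (\<Sum>(d, j)\<in>A. fract_eval (D (d, j)) / fract_eval d ^ j)"
    by blast
  then show ?thesis by (intro that[of A D]; blast)
qed

text \<open>The difference of the two representations is a vanishing sum, so by
  \<open>pf_independent\<close> both have the same numerators; each of these lies in
  \<open>Q1\<close> and in \<open>Q2\<close>.\<close>

lemma pf_space_disjoint:
  assumes "v \<in> pf_space Q1" "v \<in> pf_space Q2"
    and Q1: "\<And>d j. 0 \<in> Q1 d j" "\<And>d j b b'. b \<in> Q1 d j \<Longrightarrow> b' \<in> Q1 d j \<Longrightarrow> b + b' \<in> Q1 d j"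
    and Q2: "\<And>d j. 0 \<in> Q2 d j" "\<And>d j b b'. b \<in> Q2 d j \<Longrightarrow> b' \<in> Q2 d j \<Longrightarrow> b + b' \<in> Q2 d j"
    and disj: "\<And>d j b. b \<in> Q1 d j \<Longrightarrow> b \<in> Q2 d j \<Longrightarrow> b = 0"
  shows "v = 0"
proof -
  obtain A D where AD: "finite A" "\<And>d j. (d, j) \<in> A \<Longrightarrow> pf_digit d j (D (d, j))"
    "\<And>d j. D (d, j) \<in> Q1 d j" "\<And>i. i \<notin> A \<Longrightarrow> D i = 0"
    "v = (\<Sum>(d, j)\<in>A. fract_eval (D (d, j)) / fract_eval d ^ j)"
    using pf_space_representation[OF assms(1) Q1] by blast
  obtain B E where BE: "finite B" "\<And>d j. (d, j) \<in> B \<Longrightarrow> pf_digit d j (E (d, j))"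
    "\<And>d j. E (d, j) \<in> Q2 d j" "\<And>i. i \<notin> B \<Longrightarrow> E i = 0"
    "v = (\<Sum>(d, j)\<in>B. fract_eval (E (d, j)) / fract_eval d ^ j)"
    using pf_space_representation[OF assms(2) Q2] by blast
  \<comment> \<open>An index occurring in only one representation carries the numerator 0 in the
    other, and this has to be a digit too.\<close>
  have digit0: "pf_digit d j 0" if "pf_digit d j b" for d j and b :: "'a fract poly"
    using that by (auto simp: pf_digit_def)
  have "D i - E i = 0" if "i \<in> A \<union> B" for i
  proof (rule pf_independent[where A = "A \<union> B" and D = "\<lambda>i. D i - E i"])
    fix d j assume "(d, j) \<in> A \<union> B"
    then obtain b where "pf_digit d j b" using AD(2) BE(2) by blast
    then have "pf_digit d j 0" by (rule digit0)
    then have "pf_digit d j (D (d, j))" "pf_digit d j (E (d, j))"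
      using AD(2,4) BE(2,4) by (cases "(d, j) \<in> A"; cases "(d, j) \<in> B"; simp)+
    then show "pf_digit d j (D (d, j) - E (d, j))"
      by (auto simp: pf_digit_def intro: degree_diff_less)
  next
    have "v = (\<Sum>(d, j)\<in>A \<union> B. fract_eval (D (d, j)) / fract_eval d ^ j)"
      unfolding AD(5) using AD(1,4) BE(1) by (intro sum.mono_neutral_left) auto
    moreover have "v = (\<Sum>(d, j)\<in>A \<union> B. fract_eval (E (d, j)) / fract_eval d ^ j)"
      unfolding BE(5) using AD(1) BE(1,4) by (intro sum.mono_neutral_left) auto
    ultimately show "(\<Sum>(d, j)\<in>A \<union> B. fract_eval (D (d, j) - E (d, j)) / fract_eval d ^ j) = 0"
      by (simp add: hom_distribs diff_divide_distrib sum_subtractf case_prod_unfold)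
  qed (use AD(1) BE(1) that in auto)
  then have "D i = E i" for i
    using AD(4) BE(4) by (cases "i \<in> A \<union> B") auto
  then have "D (d, j) = 0" for d j
    using disj[OF AD(3)[of d j]] BE(3)[of d j] by simp
  then show ?thesis
    unfolding AD(5) by (intro sum.neutral) auto
qed

subsection \<open>Twisted shifts\<close>

text \<open>A common form for all shifts on every level of the iterated polynomial ring:
  \<open>f\<close> acts on the coefficients and \<open>s\<close> translates the outer variable.
  Facts about shifts and partial fractions are thereby proved once.\<close>

definition twist :: "('a::idom \<Rightarrow> 'b::idom) \<Rightarrow> 'b \<Rightarrow> 'a poly \<Rightarrow> 'b poly" where
  "twist f s p = pcompose (map_poly f p) [:s, 1:]"

lemma pcompose_pCons_0_1 [simp]: "pcompose p (pCons 0 1) = p"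
  using pcompose_idR[of p] by (simp only: one_pCons)

lemma twist_0_right: "twist f 0 p = map_poly f p"
  by (simp add: twist_def)

lemma idom_isom_id: "idom_isom (\<lambda>a. a)"
  by standard (simp_all add: surj_def)

lemma inj_idom_hom_twist:
  assumes "inj_idom_hom f"
  shows "inj_idom_hom (twist f s)"
proof -
  interpret inj_idom_hom f by fact
  interpret m: map_poly_inj_idom_hom f ..
  show ?thesis
  proof
    fix p assume "twist f s p = 0"
    then show "p = 0"
      using pcompose_eq_0[of "map_poly f p" "[:s, 1:]"] by (simp add: twist_def)
  qed (simp_all add: twist_def hom_distribs pcompose_add pcompose_mult pcompose_1)
qed

lemma twist_degree_lead_coeff:
  assumes "inj_idom_hom f"
  shows "degree (twist f s p) = degree p" "coeff (twist f s p) (degree p) = f (lead_coeff p)"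
proof -
  interpret inj_idom_hom f by fact
  interpret m: map_poly_inj_idom_hom f ..
  show "degree (twist f s p) = degree p"
    by (simp add: twist_def degree_pcompose)
  show "coeff (twist f s p) (degree p) = f (lead_coeff p)"
    using lead_coeff_comp[of "[:s, 1:]" "map_poly f p"] by (simp add: twist_def degree_pcompose)
qed

text \<open>Surjectivity lets irreducibility pass through a shift. A preimage is found by
  translating back by \<open>- s\<close> and then lifting the coefficients.\<close>

lemma idom_isom_twist:
  assumes "idom_isom f"
  shows "idom_isom (twist f s)"
proof -
  interpret idom_isom f by fact
  have f: "inj_idom_hom f" ..
  interpret t: inj_idom_hom "twist f s" by (rule inj_idom_hom_twist[OF f])
  show ?thesis
  proof
    have "\<exists>q. twist f s q = p" for p
    proof -
      define q where "q = pcompose p [:- s, 1:]"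
      have "pcompose q [:s, 1:] = p"
        by (simp add: q_def pcompose_assoc[symmetric] pcompose_pCons)
      moreover have "\<exists>r. map_poly f r = q"
      proof (induction q)
        case (pCons a q)
        then show ?case
          using surj by (metis map_poly_pCons_hom surjD)
      qed (auto intro: exI[of _ 0])
      ultimately show ?thesis by (auto simp: twist_def)
    qed
    then show "surj (twist f s)" by (metis surjI)
  qed
qed

lemma irreducible_twist:
  "\<lbrakk>idom_isom f; irreducible p\<rbrakk> \<Longrightarrow> irreducible (twist f s p)"
proof -
  assume "idom_isom f" "irreducible p"
  interpret t: idom_isom "twist f s"
    by (rule idom_isom_twist) fact
  show ?thesis using \<open>irreducible p\<close> by simp
qed

text \<open>Both sides are ring homomorphisms in \<open>p\<close>, so it suffices to compare them on
  constants and on the variable.\<close>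

lemma fract_lift_twist_eval:
  assumes "inj_idom_hom f"
  shows "fract_lift (twist f s) (fract_eval p) = fract_eval (twist (fract_lift f) (to_fract s) p)"
proof -
  have t: "inj_idom_hom (twist f s)" by (rule inj_idom_hom_twist[OF assms])
  interpret f: inj_idom_hom f by fact
  interpret t: inj_idom_hom "twist f s" by fact
  interpret F: field_hom "fract_lift f" by (rule field_hom_fract_lift[OF assms])
  interpret T: field_hom "fract_lift (twist f s)" by (rule field_hom_fract_lift[OF t])
  have const: "fract_lift (twist f s) (const_fract u) = const_fract (fract_lift f u)" for u
  proof (cases u)
    case (Fract a b)
    have "twist f s [:a:] = [:f a:]" for a
      by (simp add: twist_def hom_distribs)
    then show ?thesis
      using Fract unfolding const_fract_def
      by (simp add: fract_lift_Fract[OF t] fract_lift_Fract[OF assms]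
          fract_lift_Fract[OF inj_idom_hom_pCons_const])
  qed
  have X: "fract_lift (twist f s) (to_fract [:0, 1:]) = const_fract (to_fract s) + to_fract [:0, 1:]"
  proof -
    have "twist f s [:0, 1:] = [:s:] + [:0, 1:]"
      by (simp add: twist_def hom_distribs pcompose_pCons)
    then show ?thesis
      by (simp only: fract_lift_to_fract[OF t] const_fract_to_fract to_fract_add)
  qed
  show ?thesis
  proof (induction p)
    case 0
    then show ?case by (simp add: twist_def[where p = 0])
  next
    case (pCons a p)
    have "twist (fract_lift f) (to_fract s) (pCons a p)
        = [:fract_lift f a:] + [:to_fract s, 1:] * twist (fract_lift f) (to_fract s) p"
      by (simp only: twist_def F.map_poly_pCons_hom pcompose_pCons)
    then have "fract_eval (twist (fract_lift f) (to_fract s) (pCons a p))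
        = const_fract (fract_lift f a) + (const_fract (to_fract s) + to_fract [:0, 1:])
          * fract_eval (twist (fract_lift f) (to_fract s) p)"
      by (simp only: fract_eval.hom_add fract_eval.hom_mult fract_eval_pCons)
        (simp add: fract_eval_pCons)
    then show ?case
      by (simp only: fract_eval_pCons T.hom_add T.hom_mult const X pCons.IH)
  qed
qed

text \<open>Twisting by an isomorphism keeps degrees, monicity and irreducibility, so it carries a
  digit at \<open>(d, j)\<close> to a digit at the twisted denominator with the same
  exponent.\<close>

lemma pf_space_twist:
  assumes f: "idom_isom f" and v: "v \<in> pf_space Q"
    and Q: "\<And>d j b. b \<in> Q d j \<Longrightarrow> twist (fract_lift f) (to_fract s) b
      \<in> Q' (twist (fract_lift f) (to_fract s) d) j"
  shows "fract_lift (twist f s) v \<in> pf_space Q'"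
proof -
  interpret f: idom_isom f by fact
  have inj: "inj_idom_hom f" ..
  interpret F: field_isom "fract_lift f" by (rule field_isom_fract_lift[OF f])
  have F: "idom_isom (fract_lift f)" "inj_idom_hom (fract_lift f)" ..
  interpret T: field_hom "fract_lift (twist f s)"
    by (rule field_hom_fract_lift[OF inj_idom_hom_twist[OF inj]])
  interpret t: inj_idom_hom "twist (fract_lift f) (to_fract s)"
    by (rule inj_idom_hom_twist[OF F(2)])
  show ?thesis
  proof (rule pf_space_image[OF v])
    fix d j b assume db: "pf_digit d j b" "b \<in> Q d j"
    have "pf_digit (twist (fract_lift f) (to_fract s) d) j (twist (fract_lift f) (to_fract s) b)"
      using db(1) irreducible_twist[OF F(1)]
      by (auto simp: pf_digit_def twist_degree_lead_coeff[OF F(2)])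
    then show "fract_lift (twist f s) (fract_eval b / fract_eval d ^ j) \<in> pf_space Q'"
      using pf_space_digit[of _ j _ Q'] Q[OF db(2)]
      by (simp add: hom_distribs fract_lift_twist_eval[OF inj])
  qed (simp_all add: hom_distribs)
qed

subsection \<open>Iterated partial fractions\<close>

definition pf_part :: "('a::idom fract poly \<times> nat) set \<Rightarrow> 'a poly fract set" where
  "pf_part S = pf_space (\<lambda>c l. if (c, l) \<in> S then UNIV else {0})"

text \<open>Only the places \<open>(c, l)\<close> of the inner variable are recorded. Denominators
  in the outer variable are left free, so that a shift of the outer variable can preserve each
  part.\<close>

definition pf_part2 :: "('a::idom fract poly \<times> nat) set \<Rightarrow> 'a poly poly fract set" where
  "pf_part2 S = pf_space (\<lambda>_ _. {b. \<forall>n. coeff b n \<in> pf_part S})"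

lemma pf_part_0: "0 \<in> pf_part S"
  by (simp add: pf_part_def pf_space.zero)

lemma pf_part_add: "\<lbrakk>u \<in> pf_part S; v \<in> pf_part S\<rbrakk> \<Longrightarrow> u + v \<in> pf_part S"
  by (simp add: pf_part_def pf_space_add)

lemma pf_part_uminus: "v \<in> pf_part S \<Longrightarrow> - v \<in> pf_part S"
  unfolding pf_part_def by (erule pf_space_uminus) (simp split: if_splits)

lemma pf_part_scale: "v \<in> pf_part S \<Longrightarrow> const_fract u * v \<in> pf_part S"
  unfolding pf_part_def by (erule pf_space_scale) (simp split: if_splits)

lemma pf_part_mono: "\<lbrakk>v \<in> pf_part S; S \<subseteq> S'\<rbrakk> \<Longrightarrow> v \<in> pf_part S'"
  unfolding pf_part_def by (erule pf_space_mono) auto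

lemma pf_part_split:
  obtains v1 v2 where "v = v1 + v2" "v1 \<in> pf_part S" "v2 \<in> pf_part (- S)"
proof (rule pf_space_split[of "\<lambda>c l. if (c, l) \<in> S then UNIV else {0}"
      "\<lambda>c l. if (c, l) \<in> - S then UNIV else {0}" v])
  fix d j and b :: "'a fract poly" assume "pf_digit d j b"
  moreover from this have "pf_digit d j 0" by (auto simp: pf_digit_def)
  ultimately show "\<exists>b1 b2. b = b1 + b2 \<and> b1 \<in> (if (d, j) \<in> S then UNIV else {0}) \<and>
      b2 \<in> (if (d, j) \<in> - S then UNIV else {0}) \<and> pf_digit d j b1 \<and> pf_digit d j b2"
    by (cases "(d, j) \<in> S") (auto intro: exI[of _ b] exI[of _ 0])
qed (use that in \<open>simp add: pf_part_def\<close>)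

lemma pf_part_disjoint: "\<lbrakk>v \<in> pf_part S; v \<in> pf_part (- S)\<rbrakk> \<Longrightarrow> v = 0"
  unfolding pf_part_def by (erule (1) pf_space_disjoint) (auto split: if_splits)

lemma pf_part2_0: "0 \<in> pf_part2 S"
  by (simp add: pf_part2_def pf_space.zero)

lemma pf_part2_add: "\<lbrakk>u \<in> pf_part2 S; v \<in> pf_part2 S\<rbrakk> \<Longrightarrow> u + v \<in> pf_part2 S"
  by (simp add: pf_part2_def pf_space_add)

lemma pf_part2_uminus: "v \<in> pf_part2 S \<Longrightarrow> - v \<in> pf_part2 S"
  unfolding pf_part2_def by (erule pf_space_uminus) (simp add: pf_part_uminus)

lemma pf_part2_diff: "\<lbrakk>u \<in> pf_part2 S; v \<in> pf_part2 S\<rbrakk> \<Longrightarrow> u - v \<in> pf_part2 S"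
  using pf_part2_add[OF _ pf_part2_uminus] by fastforce

lemma pf_part2_sum: "(\<And>i. i \<in> A \<Longrightarrow> f i \<in> pf_part2 S) \<Longrightarrow> (\<Sum>i\<in>A. f i) \<in> pf_part2 S"
  by (induction A rule: infinite_finite_induct) (auto intro: pf_part2_0 pf_part2_add)

lemma pf_part2_scale: "v \<in> pf_part2 S \<Longrightarrow> const_fract (const_fract u) * v \<in> pf_part2 S"
  unfolding pf_part2_def by (erule pf_space_scale) (simp add: pf_part_scale)

lemma pf_part2_mono: "\<lbrakk>v \<in> pf_part2 S; S \<subseteq> S'\<rbrakk> \<Longrightarrow> v \<in> pf_part2 S'"
  unfolding pf_part2_def by (erule pf_space_mono) (auto intro: pf_part_mono)

lemma poly_pf_part_split:
  fixes b :: "'a::idom poly fract poly"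
  obtains b1 b2 where "b = b1 + b2" "degree b1 \<le> degree b" "degree b2 \<le> degree b"
    "\<And>n. coeff b1 n \<in> pf_part S" "\<And>n. coeff b2 n \<in> pf_part (- S)"
proof -
  have "\<forall>v. \<exists>v1. v1 \<in> pf_part S \<and> v - v1 \<in> pf_part (- S)" for S :: "('a fract poly \<times> nat) set"
    by (metis add_diff_cancel_left' pf_part_split)
  then obtain P where P: "\<And>v. P v \<in> pf_part S" "\<And>v. v - P v \<in> pf_part (- S)" by metis
  \<comment> \<open>Truncation at the degree of \<open>b\<close> yields a polynomial without any
    appeal to the value of \<open>P\<close> at 0.\<close>
  define b1 where "b1 = Poly (map P (map (coeff b) [0..<Suc (degree b)]))"
  have coeff: "coeff b1 n = (if n \<le> degree b then P (coeff b n) else 0)" for n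
    by (simp add: b1_def nth_default_def del: upt_Suc)
  show ?thesis
  proof (rule that[of b1 "b - b1"])
    show "degree b1 \<le> degree b" by (rule degree_le) (simp add: coeff)
    then show "degree (b - b1) \<le> degree b" by (simp add: degree_diff_le)
    show "coeff b1 n \<in> pf_part S" "coeff (b - b1) n \<in> pf_part (- S)" for n
      using P by (simp_all add: coeff pf_part_0 coeff_eq_0)
  qed simp
qed

text \<open>Together with \<open>pf_part2_disjoint\<close> this is a direct sum decomposition. Only
  the coefficients of the numerators are split, so the outer denominators are unchanged.\<close>

lemma pf_part2_split:
  obtains v1 v2 where "v = v1 + v2" "v1 \<in> pf_part2 S" "v2 \<in> pf_part2 (- S)"
proof (rule pf_space_split[of "\<lambda>_ _. {b. \<forall>n. coeff b n \<in> pf_part S}"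
      "\<lambda>_ _. {b. \<forall>n. coeff b n \<in> pf_part (- S)}" v])
  fix d j and b :: "'a poly fract poly" assume digit: "pf_digit d j b"
  obtain b1 b2 where b: "b = b1 + b2" "degree b1 \<le> degree b" "degree b2 \<le> degree b"
    "\<And>n. coeff b1 n \<in> pf_part S" "\<And>n. coeff b2 n \<in> pf_part (- S)"
    by (rule poly_pf_part_split[of b S]) blast
  then show "\<exists>b1 b2. b = b1 + b2 \<and> b1 \<in> {b. \<forall>n. coeff b n \<in> pf_part S} \<and>
      b2 \<in> {b. \<forall>n. coeff b n \<in> pf_part (- S)} \<and> pf_digit d j b1 \<and> pf_digit d j b2"
    using digit by (intro exI[of _ b1] exI[of _ b2]) (auto simp: pf_digit_def)
qed (use that in \<open>simp add: pf_part2_def\<close>)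

lemma pf_part2_disjoint: "\<lbrakk>v \<in> pf_part2 S; v \<in> pf_part2 (- S)\<rbrakk> \<Longrightarrow> v = 0"
  unfolding pf_part2_def
  by (erule (1) pf_space_disjoint)
    (auto simp: pf_part_0 poly_eq_iff intro: pf_part_add pf_part_disjoint)

lemma pf_part_twist:
  assumes "idom_isom f" "v \<in> pf_part S"
    and "\<And>c l. (c, l) \<in> S \<Longrightarrow> (twist (fract_lift f) (to_fract s) c, l) \<in> S'"
  shows "fract_lift (twist f s) v \<in> pf_part S'"
  using assms(2) unfolding pf_part_def
  by (rule pf_space_twist[OF assms(1)])
    (use assms(3) in \<open>auto simp: twist_def split: if_splits\<close>)

text \<open>The inner twist moves the places. Translation of the outer variable by a constant
  \<open>[:t:]\<close> merely forms linear combinations of coefficients with scalars free of the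
  inner variable, and the parts are closed under these.\<close>

lemma pf_part2_twist:
  assumes f: "idom_isom f" and v: "v \<in> pf_part2 S"
    and S: "\<And>c l. (c, l) \<in> S \<Longrightarrow> (twist (fract_lift f) (to_fract s) c, l) \<in> S'"
  shows "fract_lift (twist (twist f s) [:t:]) v \<in> pf_part2 S'"
  using v unfolding pf_part2_def
proof (rule pf_space_twist[OF idom_isom_twist[OF f]])
  interpret t: idom_isom "twist f s" by (rule idom_isom_twist[OF f])
  interpret T: field_hom "fract_lift (twist f s)"
    by (rule field_hom_fract_lift) unfold_locales
  fix b :: "'a poly fract poly"
  assume "b \<in> {b. \<forall>n. coeff b n \<in> pf_part S}"
  then have b: "coeff (map_poly (fract_lift (twist f s)) b) n \<in> pf_part S'" for n
    using pf_part_twist[OF f, of "coeff b n" S s S'] S by simp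
  have "coeff (pcompose p [:to_fract [:t:], 1:]) n \<in> pf_part S'"
    if "\<And>n. coeff p n \<in> pf_part S'" for p n
    using that
  proof (induction p arbitrary: n)
    case (pCons a p)
    have "coeff p n \<in> pf_part S'" "a \<in> pf_part S'" for n
      using pCons.prems[of "Suc n"] pCons.prems[of 0] by simp_all
    then show ?case
      using pCons.IH by (auto simp: pcompose_pCons coeff_pCons const_fract_to_fract[symmetric]
          intro!: pf_part_add pf_part_scale pf_part_0 split: nat.split
          simp del: coeff_pcompose_0)
  qed (simp add: pf_part_0)
  then show "twist (fract_lift (twist f s)) (to_fract [:t:]) b
      \<in> {b. \<forall>n. coeff b n \<in> pf_part S'}"
    using b by (simp add: twist_def)
qed

subsection \<open>The shifts on \<open>K(x, y, z)\<close>\<close>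

definition shx1 :: "int \<Rightarrow> 'k::field_char_0 poly \<Rightarrow> 'k poly" where
  "shx1 n = twist (\<lambda>a. a) (of_int n)"

text \<open>This and \<open>shy_frac\<close> are the actions of the shifts on denominators in
  K(x)[y], written as twists in the shape that \<open>pf_part2_twist\<close> expects.\<close>

definition shx_frac :: "int \<Rightarrow> 'k::field_char_0 poly fract poly \<Rightarrow> 'k poly fract poly" where
  "shx_frac n = twist (fract_lift (shx1 n)) (to_fract 0)"

definition shy_frac :: "int \<Rightarrow> 'k::field_char_0 poly fract poly \<Rightarrow> 'k poly fract poly" where
  "shy_frac n = twist (fract_lift (\<lambda>a. a)) (to_fract [:of_int n:])"

lemma twist_id_0: "twist (\<lambda>a. a) 0 = (\<lambda>p. p)"
  by (simp add: fun_eq_iff twist_0_right)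

lemma shx2_twist: "shx2 n = twist (shx1 n) 0"
  by (simp add: fun_eq_iff shx2_def shx1_def twist_0_right twist_def[of "\<lambda>a. a", abs_def])

lemma shy2_twist: "shy2 n = twist (\<lambda>a. a) [:of_int n:]"
  by (simp add: fun_eq_iff shy2_def twist_def)

lemma shx_twist: "shx n = twist (twist (shx1 n) 0) [:0:]"
  by (simp add: fun_eq_iff shx_def shx2_twist twist_0_right)

lemma shy_twist: "shy n = twist (twist (\<lambda>a. a) [:of_int n:]) [:0:]"
  by (simp add: fun_eq_iff shy_def shy2_twist twist_0_right)

lemma shz_twist: "shz n = twist (twist (\<lambda>a. a) 0) [:[:of_int n:]:]"
  by (simp add: fun_eq_iff shz_def twist_id_0 twist_def[of "\<lambda>a. a"])

lemma idom_isom_shx1: "idom_isom (shx1 n)"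
  unfolding shx1_def by (intro idom_isom_twist idom_isom_id)

lemma idom_isom_shx2: "idom_isom (shx2 n)"
  unfolding shx2_twist by (intro idom_isom_twist idom_isom_shx1)

lemma idom_isom_shy2: "idom_isom (shy2 n)"
  unfolding shy2_twist by (intro idom_isom_twist idom_isom_id)

lemma inj_idom_hom_of_isom: "idom_isom f \<Longrightarrow> inj_idom_hom f"
  by (rule idom_isom.axioms)

lemma inj_idom_hom_shx1: "inj_idom_hom (shx1 n)"
  and inj_idom_hom_shx2: "inj_idom_hom (shx2 n)"
  and inj_idom_hom_shy2: "inj_idom_hom (shy2 n)"
  by (intro inj_idom_hom_of_isom idom_isom_shx1 idom_isom_shx2 idom_isom_shy2)+

lemma inj_idom_hom_shx: "inj_idom_hom (shx n)"
  and inj_idom_hom_shy: "inj_idom_hom (shy n)"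
  and inj_idom_hom_shz: "inj_idom_hom (shz n)"
  unfolding shx_twist shy_twist shz_twist
  by (intro inj_idom_hom_of_isom idom_isom_twist idom_isom_id idom_isom_shx1)+

lemma zero_hom_inj_idom_hom: "inj_idom_hom f \<Longrightarrow> f 0 = 0"
proof -
  assume "inj_idom_hom f"
  then interpret inj_idom_hom f .
  show ?thesis by simp
qed

lemma shx1_add: "shx1 m (shx1 n p) = shx1 (m + n) p"
  by (simp add: shx1_def twist_def pcompose_assoc[symmetric] pcompose_pCons add.commute)

lemma shx1_0: "shx1 0 p = p"
  by (simp add: shx1_def twist_def)

lemma shx1_const: "shx1 n [:a:] = [:a:]"
  by (simp add: shx1_def twist_def)

lemma map_poly_hom_comp:
  assumes "inj_idom_hom f" "inj_idom_hom g"
  shows "map_poly f (map_poly g p) = map_poly (\<lambda>a. f (g a)) p"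
proof -
  interpret f: inj_idom_hom f by fact
  interpret g: inj_idom_hom g by fact
  show ?thesis by (rule poly_eqI) (simp add: coeff_map_poly)
qed

lemma map_poly_pcompose_shift:
  assumes "inj_idom_hom f"
  shows "map_poly f (pcompose p (pCons s 1)) = pcompose (map_poly f p) (pCons (f s) 1)"
proof -
  interpret f: inj_idom_hom f by fact
  show ?thesis by (simp add: hom_distribs)
qed

lemma shx2_add: "shx2 m (shx2 n p) = shx2 (m + n) p"
  by (simp add: shx2_twist twist_0_right map_poly_hom_comp inj_idom_hom_shx1 shx1_add)

lemma shx_add: "shx m (shx n p) = shx (m + n) p"
  by (simp add: shx_def map_poly_hom_comp inj_idom_hom_shx2 shx2_add)

lemma shx_0: "shx 0 p = p"
  by (simp add: shx_def shx2_twist twist_0_right[abs_def] shx1_0[abs_def])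

lemma shx2_shy2: "shx2 m (shy2 n p) = shy2 n (shx2 m p)"
  by (simp add: shx2_twist shy2_def twist_0_right map_poly_pcompose_shift inj_idom_hom_shx1
      shx1_const)

lemma shx_shy: "shx m (shy n p) = shy n (shx m p)"
  by (simp add: shx_def shy_def map_poly_hom_comp inj_idom_hom_shx2 inj_idom_hom_shy2 shx2_shy2)

lemma shx_shz: "shx m (shz n p) = shz n (shx m p)"
proof -
  have "shx2 m [:[:of_int n:]:] = ([:[:of_int n:]:] :: 'a pxy)"
    by (rule poly_eqI) (simp add: shx2_twist twist_0_right coeff_map_poly coeff_pCons shx1_const
        inj_idom_hom_shx1[THEN zero_hom_inj_idom_hom] split: nat.split)
  then show ?thesis
    by (simp add: shx_def shz_def map_poly_pcompose_shift inj_idom_hom_shx2)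
qed

lemma field_hom_inj_idom_hom: "field_hom f \<Longrightarrow> inj_idom_hom f"
proof -
  assume "field_hom f"
  then interpret field_hom f .
  show ?thesis ..
qed

lemma inj_idom_hom_fract_lift_shx1: "inj_idom_hom (fract_lift (shx1 n))"
  by (intro field_hom_inj_idom_hom field_hom_fract_lift inj_idom_hom_shx1)

lemma shx_frac_map_poly: "shx_frac n p = map_poly (fract_lift (shx1 n)) p"
  by (simp add: shx_frac_def twist_0_right)

lemma shy_frac_pcompose: "shy_frac n p = pcompose p [:to_fract [:of_int n:], 1:]"
  by (simp add: shy_frac_def twist_def fract_lift_id[abs_def])

lemma shx_frac_add: "shx_frac m (shx_frac n p) = shx_frac (m + n) p"
  by (simp add: shx_frac_map_poly map_poly_hom_comp inj_idom_hom_fract_lift_shx1 fract_lift_comp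
      inj_idom_hom_shx1 shx1_add)

lemma shx_frac_0: "shx_frac 0 p = p"
  by (simp add: shx_frac_map_poly shx1_0[abs_def] fract_lift_id[abs_def])

lemma shy_frac_add: "shy_frac m (shy_frac n p) = shy_frac (m + n) p"
  by (simp add: shy_frac_pcompose pcompose_assoc[symmetric] pcompose_pCons add.commute flip: to_fract_add)

lemma shy_frac_0: "shy_frac 0 p = p"
  by (simp add: shy_frac_pcompose)

lemma shx_frac_shy_frac: "shx_frac m (shy_frac n p) = shy_frac n (shx_frac m p)"
  by (simp add: shx_frac_map_poly shy_frac_pcompose map_poly_pcompose_shift inj_idom_hom_fract_lift_shx1
      fract_lift_to_fract inj_idom_hom_shx1 shx1_const)

lemma sigx_lift: "sigx n = fract_lift (shx n)"
  and sigy_lift: "sigy n = fract_lift (shy n)"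
  and sigz_lift: "sigz n = fract_lift (shz n)"
  by (simp_all add: sigx_def sigy_def sigz_def fr_map_eq_fract_lift)

interpretation sigx: field_hom "sigx n"
  unfolding sigx_lift by (rule field_hom_fract_lift[OF inj_idom_hom_shx])

interpretation sigy: field_hom "sigy n"
  unfolding sigy_lift by (rule field_hom_fract_lift[OF inj_idom_hom_shy])

interpretation sigz: field_hom "sigz n"
  unfolding sigz_lift by (rule field_hom_fract_lift[OF inj_idom_hom_shz])

lemma sigx_add: "sigx m (sigx n v) = sigx (m + n) v"
  by (simp add: sigx_lift fract_lift_comp inj_idom_hom_shx shx_add)

lemma sigx_0: "sigx 0 v = v"
  by (simp add: sigx_lift shx_0[abs_def] fract_lift_id)

lemma sigx_sigy: "sigx m (sigy n v) = sigy n (sigx m v)"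
  by (simp add: sigx_lift sigy_lift fract_lift_comp inj_idom_hom_shx inj_idom_hom_shy shx_shy)

lemma sigx_sigz: "sigx m (sigz n v) = sigz n (sigx m v)"
  by (simp add: sigx_lift sigz_lift fract_lift_comp inj_idom_hom_shx inj_idom_hom_shz shx_shz)

lemma sigy_const: "sigy n (const_fract (const_fract u)) = const_fract (const_fract u)"
  and sigz_const: "sigz n (const_fract (const_fract u)) = const_fract (const_fract u)"
proof -
  obtain a b where u: "u = Fract a b" by (cases u)
  have c: "const_fract (const_fract u) = Fract [:[:a:]:] [:[:b:]:]"
    by (simp add: u const_fract_def fract_lift_Fract[OF inj_idom_hom_pCons_const])
  have "shy n [:[:p:]:] = [:[:p:]:]" "shz n [:[:p:]:] = [:[:p:]:]" for p :: "'a poly"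
    by (rule poly_eqI, simp add: shy_def shy2_def coeff_map_poly coeff_pCons split: nat.split)
      (simp add: shz_def)
  then show "sigy n (const_fract (const_fract u)) = const_fract (const_fract u)"
    "sigz n (const_fract (const_fract u)) = const_fract (const_fract u)"
    by (simp_all add: c sigy_lift sigz_lift fract_lift_Fract inj_idom_hom_shy inj_idom_hom_shz)
qed

lemma pf_part2_sigx:
  "\<lbrakk>v \<in> pf_part2 S; \<And>c l. (c, l) \<in> S \<Longrightarrow> (shx_frac n c, l) \<in> S'\<rbrakk> \<Longrightarrow> sigx n v \<in> pf_part2 S'"
  unfolding sigx_lift shx_twist
  by (rule pf_part2_twist[OF idom_isom_shx1]) (auto simp: shx_frac_def)

lemma pf_part2_sigy:
  "\<lbrakk>v \<in> pf_part2 S; \<And>c l. (c, l) \<in> S \<Longrightarrow> (shy_frac n c, l) \<in> S'\<rbrakk> \<Longrightarrow> sigy n v \<in> pf_part2 S'"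
  unfolding sigy_lift shy_twist
  by (rule pf_part2_twist[OF idom_isom_id]) (auto simp: shy_frac_def)

text \<open>A shift in \<open>z\<close> translates the outer variable only, so every place in
  \<open>y\<close> stays fixed.\<close>

lemma pf_part2_sigz: "v \<in> pf_part2 S \<Longrightarrow> sigz n v \<in> pf_part2 S"
  unfolding sigz_lift shz_twist
  by (rule pf_part2_twist[OF idom_isom_id]) (auto simp: twist_0_right fract_lift_id[abs_def])

subsection \<open>Summability\<close>

lemma yz_summableI: "f = sigy 1 u - u + sigz 1 v - v \<Longrightarrow> yz_summable f"
  by (auto simp: yz_summable_def)

lemma yz_summable_add:
  assumes "yz_summable f" "yz_summable g"
  shows "yz_summable (f + g)"
proof -
  obtain u v u' v' where *: "f = sigy 1 u - u + sigz 1 v - v" "g = sigy 1 u' - u' + sigz 1 v' - v'"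
    using assms by (auto simp: yz_summable_def)
  show ?thesis
    unfolding *
    by (intro yz_summableI[of _ "u + u'" "v + v'"])
      (simp add: sigy.hom_add sigz.hom_add algebra_simps)
qed

lemma yz_summable_scale:
  assumes "yz_summable f"
  shows "yz_summable (const_fract (const_fract a) * f)"
proof -
  obtain u v where *: "f = sigy 1 u - u + sigz 1 v - v"
    using assms by (auto simp: yz_summable_def)
  show ?thesis
    unfolding *
    by (intro yz_summableI[of _ "const_fract (const_fract a) * u" "const_fract (const_fract a) * v"])
      (simp add: sigy.hom_mult sigz.hom_mult sigy_const sigz_const algebra_simps)
qed

lemma yz_summable_0: "yz_summable 0"
  unfolding yz_summable_def by (intro exI[of _ 0]) simp

lemma yz_summable_sum: "(\<And>i. i \<in> A \<Longrightarrow> yz_summable (f i)) \<Longrightarrow> yz_summable (\<Sum>i\<in>A. f i)"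
  by (induction A rule: infinite_finite_induct) (auto intro: yz_summable_0 yz_summable_add)

lemma yz_summable_diff: "\<lbrakk>yz_summable f; yz_summable g\<rbrakk> \<Longrightarrow> yz_summable (f - g)"
  using yz_summable_add[of f "- g"] yz_summable_scale[of g "- 1"] by (simp add: hom_distribs)

lemma yz_summable_sigx:
  assumes "yz_summable f"
  shows "yz_summable (sigx n f)"
proof -
  obtain u v where *: "f = sigy 1 u - u + sigz 1 v - v"
    using assms by (auto simp: yz_summable_def)
  show ?thesis
    unfolding *
    by (intro yz_summableI[of _ "sigx n u" "sigx n v"])
      (simp add: sigx.hom_add sigx.hom_minus sigx_sigy sigx_sigz)
qed

text \<open>The summation identity is projected to the part of \<open>S\<close>. The equivalence in
  the hypothesis makes both \<open>S\<close> and its complement stable under \<open>sigy 1\<close>,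
  so the error term of the projected identity lies in both parts and vanishes.\<close>

lemma yz_summable_pf_part2:
  assumes S: "\<And>c l. (shy_frac 1 c, l) \<in> S \<longleftrightarrow> (c, l) \<in> S"
    and f: "f \<in> pf_part2 S" and g: "g \<in> pf_part2 (- S)" and sum: "yz_summable (f + g)"
  shows "yz_summable f"
proof -
  obtain u v where uv: "f + g = sigy 1 u - u + sigz 1 v - v"
    using sum by (auto simp: yz_summable_def)
  obtain u1 u2 where u: "u = u1 + u2" "u1 \<in> pf_part2 S" "u2 \<in> pf_part2 (- S)"
    by (rule pf_part2_split)
  obtain v1 v2 where v: "v = v1 + v2" "v1 \<in> pf_part2 S" "v2 \<in> pf_part2 (- S)"
    by (rule pf_part2_split)
  have "sigy 1 u1 - u1 + sigz 1 v1 - v1 - f \<in> pf_part2 S"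
    using S by (intro pf_part2_add pf_part2_diff pf_part2_sigy[of u1 S] pf_part2_sigz u v f) auto
  moreover have "sigy 1 u1 - u1 + sigz 1 v1 - v1 - f = g - (sigy 1 u2 - u2 + sigz 1 v2 - v2)"
    using uv unfolding u v by (simp add: sigy.hom_add sigz.hom_add algebra_simps)
  moreover have "g - (sigy 1 u2 - u2 + sigz 1 v2 - v2) \<in> pf_part2 (- S)"
    using S by (intro pf_part2_add pf_part2_diff pf_part2_sigy[of u2 "- S"] pf_part2_sigz u v g) auto
  ultimately have "sigy 1 u1 - u1 + sigz 1 v1 - v1 - f = 0"
    using pf_part2_disjoint by metis
  then show ?thesis
    unfolding yz_summable_def by (intro exI[of _ u1] exI[of _ v1]) simp
qed

subsection \<open>Functions with telescopers\<close>

text \<open>\<open>\<omega> t\<close> is the place of the summand \<open>\<rho> t\<close>. The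
  induction removes all summands of one shift orbit in \<open>y\<close> at a time, keeping the
  operator fixed.\<close>

lemma telescoper_imp_yz_summable:
  fixes \<omega> :: "'t \<Rightarrow> 'k::field_char_0 poly fract poly \<times> nat" and a :: "nat \<Rightarrow> 'k poly fract"
  assumes "finite T" and "\<And>t. t \<in> T \<Longrightarrow> \<rho> t \<in> pf_part2 {\<omega> t}"
    and "\<And>t n k. t \<in> T \<Longrightarrow> n > 0 \<Longrightarrow> shx_frac n (fst (\<omega> t)) \<noteq> shy_frac k (fst (\<omega> t))"
    and "a N \<noteq> 0"
    and "yz_summable (\<Sum>i\<le>N. const_fract (const_fract (a i)) * sigx (int i) (\<Sum>t\<in>T. \<rho> t))"
  shows "yz_summable (\<Sum>t\<in>T. \<rho> t)"
  using assms(1-3,5)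
proof (induction T rule: finite_psubset_induct)
  case (psubset T)
  note mem = psubset.prems(1) and free = psubset.prems(2) and summable = psubset.prems(3)
  show ?case
  proof (cases "T = {}")
    case True
    then show ?thesis by (simp add: yz_summable_0)
  next
    case False
    \<comment> \<open>\<open>R t t'\<close> says that a positive shift in \<open>x\<close>, up to
      shifts in \<open>y\<close>, carries the place of \<open>t\<close> to that of
      \<open>t'\<close>. The third hypothesis makes \<open>R\<close> irreflexive on
      \<open>T\<close>, so this strict order has a maximal element.\<close>
    define R where "R = (\<lambda>t t'. \<exists>n>0. \<exists>k. \<omega> t' = (shx_frac n (shy_frac k (fst (\<omega> t))), snd (\<omega> t)))"
    have irrefl: "\<not> R t t" if "t \<in> T" for t
    proof
      assume "R t t"
      then obtain n k where n: "n > 0" "fst (\<omega> t) = shx_frac n (shy_frac k (fst (\<omega> t)))"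
        by (metis R_def fst_conv)
      then have "shy_frac (- k) (fst (\<omega> t)) = shx_frac n (fst (\<omega> t))"
        by (metis shx_frac_shy_frac shy_frac_add shy_frac_0 add.left_inverse)
      then show False using free[OF that n(1)] by metis
    qed
    have trans: "R t t''" if R: "R t t'" "R t' t''" for t t' t''
    proof -
      obtain n k where n: "n > 0" "\<omega> t' = (shx_frac n (shy_frac k (fst (\<omega> t))), snd (\<omega> t))"
        using R(1) unfolding R_def by blast
      obtain n' k' where n': "n' > 0" "\<omega> t'' = (shx_frac n' (shy_frac k' (fst (\<omega> t'))), snd (\<omega> t'))"
        using R(2) unfolding R_def by blast
      have "\<omega> t'' = (shx_frac (n' + n) (shy_frac (k' + k) (fst (\<omega> t))), snd (\<omega> t))"
        using n n' by (simp add: shx_frac_shy_frac[symmetric] shx_frac_add shy_frac_add)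
      moreover have "n' + n > 0" using n n' by simp
      ultimately show ?thesis unfolding R_def by blast
    qed
    have "asymp_on T R" "transp_on T R"
      using irrefl trans by (auto intro!: asymp_onI transp_onI)
    then obtain t0 where t0: "t0 \<in> T" "\<And>t. t \<in> T \<Longrightarrow> \<not> R t0 t"
      using Finite_Set.bex_max_element[of T R] psubset.hyps False irrefl by metis
    define c where "c = fst (\<omega> t0)"
    define l where "l = snd (\<omega> t0)"
    \<comment> \<open>\<open>S\<close> is the orbit of the place of \<open>t0\<close> after the
      leading shift by \<open>N\<close>; \<open>T0\<close> below consists of the summands on that
      orbit before the shift.\<close>
    define S where "S = {(shx_frac (int N) (shy_frac k c), l) | k. True}"
    define T0 where "T0 = {t \<in> T. \<exists>k. \<omega> t = (shy_frac k c, l)}"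
    have S_inv: "(shy_frac 1 e, m) \<in> S \<longleftrightarrow> (e, m) \<in> S" for e m
    proof
      assume "(shy_frac 1 e, m) \<in> S"
      then obtain k where "shy_frac 1 e = shx_frac (int N) (shy_frac k c)" "m = l" by (auto simp: S_def)
      then have "e = shx_frac (int N) (shy_frac (- 1 + k) c)"
        by (metis shx_frac_shy_frac shy_frac_add shy_frac_0 add.left_inverse)
      then show "(e, m) \<in> S" using \<open>m = l\<close> by (auto simp: S_def)
    next
      assume "(e, m) \<in> S"
      then obtain k where "e = shx_frac (int N) (shy_frac k c)" "m = l" by (auto simp: S_def)
      then have "shy_frac 1 e = shx_frac (int N) (shy_frac (1 + k) c)"
        by (metis shx_frac_shy_frac shy_frac_add)
      then show "(shy_frac 1 e, m) \<in> S" using \<open>m = l\<close> by (auto simp: S_def)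
    qed
    let ?C = "\<lambda>i. const_fract (const_fract (a i))"
    have T0: "T0 \<subseteq> T" "t0 \<in> T0"
      using t0(1) shy_frac_0[of c] by (auto simp: T0_def c_def l_def prod_eq_iff intro!: exI[of _ 0])
    have split: "(\<Sum>t\<in>T. \<rho> t) = (\<Sum>t\<in>T0. \<rho> t) + (\<Sum>t\<in>T - T0. \<rho> t)"
      using sum.subset_diff[OF T0(1) psubset.hyps, of \<rho>] by (simp add: add.commute)
    define top where "top = ?C N * sigx (int N) (\<Sum>t\<in>T0. \<rho> t)"
    \<comment> \<open>Everything but the leading coefficient acting on \<open>T0\<close>: all lower
      shifts, and the leading shift of the other summands.\<close>
    define rest where "rest = (\<Sum>i<N. ?C i * sigx (int i) (\<Sum>t\<in>T. \<rho> t))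
      + ?C N * sigx (int N) (\<Sum>t\<in>T - T0. \<rho> t)"
    have "(\<Sum>i\<le>N. ?C i * sigx (int i) (\<Sum>t\<in>T. \<rho> t)) = top + rest"
      unfolding lessThan_Suc_atMost[symmetric] top_def rest_def sum.lessThan_Suc
      by (simp add: split sigx.hom_add distrib_left)
    then have "yz_summable (top + rest)"
      using summable by simp
    moreover have "top \<in> pf_part2 S"
      unfolding top_def sigx.hom_sum
    proof (intro pf_part2_scale pf_part2_sum)
      fix t assume "t \<in> T0"
      then show "sigx (int N) (\<rho> t) \<in> pf_part2 S"
        by (intro pf_part2_sigx[of _ "{\<omega> t}"] mem) (auto simp: T0_def S_def)
    qed
    moreover have "rest \<in> pf_part2 (- S)"
      unfolding rest_def sigx.hom_sum
    proof (intro pf_part2_add pf_part2_scale pf_part2_sum)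
      fix i t assume i: "i \<in> {..<N}" and t: "t \<in> T"
      \<comment> \<open>A lower shift landing in \<open>S\<close> would place \<open>t\<close> at
        the positive distance \<open>N - i\<close> beyond \<open>t0\<close>, against
        maximality.\<close>
      show "sigx (int i) (\<rho> t) \<in> pf_part2 (- S)"
      proof (intro pf_part2_sigx[of _ "{\<omega> t}"] mem t)
        fix e m assume em: "(e, m) \<in> {\<omega> t}"
        show "(shx_frac (int i) e, m) \<in> - S"
        proof
          assume "(shx_frac (int i) e, m) \<in> S"
          then obtain k where k: "shx_frac (int i) e = shx_frac (int N) (shy_frac k c)" "m = l"
            by (auto simp: S_def)
          then have "shx_frac (- int i) (shx_frac (int i) e) = shx_frac (- int i) (shx_frac (int N) (shy_frac k c))" by simp
          then have "e = shx_frac (int N - int i) (shy_frac k c)"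
            by (simp add: shx_frac_add shx_frac_0)
          then have "\<omega> t = (shx_frac (int N - int i) (shy_frac k (fst (\<omega> t0))), snd (\<omega> t0))"
            using em k(2) by (simp add: c_def l_def)
          moreover have "int N - int i > 0" using i by simp
          ultimately have "R t0 t" unfolding R_def by blast
          then show False using t0(2)[OF t] by simp
        qed
      qed
    next
      fix t assume t: "t \<in> T - T0"
      then have tT: "t \<in> T" by simp
      \<comment> \<open>Here the shift by \<open>N\<close> cancels, so landing in \<open>S\<close>
        would put \<open>t\<close> into \<open>T0\<close>.\<close>
      show "sigx (int N) (\<rho> t) \<in> pf_part2 (- S)"
      proof (intro pf_part2_sigx[of _ "{\<omega> t}"] mem tT)
        fix e m assume em: "(e, m) \<in> {\<omega> t}"
        show "(shx_frac (int N) e, m) \<in> - S"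
        proof
          assume "(shx_frac (int N) e, m) \<in> S"
          then obtain k where k: "shx_frac (int N) e = shx_frac (int N) (shy_frac k c)" "m = l"
            by (auto simp: S_def)
          then have "shx_frac (- int N) (shx_frac (int N) e) = shx_frac (- int N) (shx_frac (int N) (shy_frac k c))" by simp
          then have "e = shy_frac k c" by (simp add: shx_frac_add shx_frac_0)
          then have "\<omega> t = (shy_frac k c, l)" using em k(2) by simp
          then show False using t by (auto simp: T0_def)
        qed
      qed
    qed
    ultimately have "yz_summable top"
      using yz_summable_pf_part2[of S top rest] S_inv by blast
    \<comment> \<open>Dividing by the leading coefficient and undoing the shift by \<open>N\<close>
      both preserve summability.\<close>
    then have "yz_summable (const_fract (const_fract (inverse (a N))) * top)"
      by (rule yz_summable_scale)
    moreover have "const_fract (const_fract (inverse (a N))) * top = sigx (int N) (\<Sum>t\<in>T0. \<rho> t)"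
      using assms(4) by (simp add: top_def const_fract.hom_inverse)
    ultimately have "yz_summable (sigx (- int N) (sigx (int N) (\<Sum>t\<in>T0. \<rho> t)))"
      by (simp only: yz_summable_sigx)
    then have top_summable: "yz_summable (\<Sum>t\<in>T0. \<rho> t)"
      by (simp only: sigx_add sigx_0 add.left_inverse)
    \<comment> \<open>The operator maps the summable part on \<open>T0\<close> to something
      summable, so the same operator serves for the remaining summands.\<close>
    have "yz_summable (\<Sum>t\<in>T - T0. \<rho> t)"
    proof (rule psubset.IH)
      have "yz_summable ((\<Sum>i\<le>N. ?C i * sigx (int i) (\<Sum>t\<in>T. \<rho> t))
          - (\<Sum>i\<le>N. ?C i * sigx (int i) (\<Sum>t\<in>T0. \<rho> t)))"
        by (intro yz_summable_diff summable yz_summable_sum yz_summable_scale yz_summable_sigx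
            top_summable)
      then show "yz_summable (\<Sum>i\<le>N. ?C i * sigx (int i) (\<Sum>t\<in>T - T0. \<rho> t))"
        by (simp add: split sigx.hom_add distrib_left sum.distrib)
    qed (use T0 mem free in auto)
    then show ?thesis
      unfolding split by (rule yz_summable_add[OF top_summable])
  qed
qed

section \<open>Locating the given summands: monic normalisation and the leading coefficient of
  \<open>d\<close>\<close>

definition monic_fract :: "'a::idom poly \<Rightarrow> 'a fract poly" where
  "monic_fract p = smult (inverse (to_fract (lead_coeff p))) (map_poly to_fract p)"

lemma degree_monic_fract [simp]: "degree (monic_fract p) = degree p"
  by (cases "p = 0") (simp_all add: monic_fract_def)

lemma lead_coeff_monic_fract: "p \<noteq> 0 \<Longrightarrow> lead_coeff (monic_fract p) = 1"
  by (simp add: monic_fract_def)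

text \<open>Gauss's lemma. Positive degree excludes irreducible constants, which become units over
  the fraction field.\<close>

lemma irreducible_monic_fract:
  fixes p :: "'a::ufd poly"
  assumes "irreducible p" "degree p > 0"
  shows "irreducible (monic_fract p)"
  using irreducible_PM_M_PFM[OF assms(1)] assms
  by (auto simp: monic_fract_def irreducible_smult_field)

lemma to_fract_eq_monic_fract:
  "p \<noteq> 0 \<Longrightarrow> to_fract p = const_fract (to_fract (lead_coeff p)) * fract_eval (monic_fract p)"
proof -
  assume "p \<noteq> 0"
  then have "map_poly to_fract p = [:to_fract (lead_coeff p):] * monic_fract p"
    by (simp add: monic_fract_def)
  then show ?thesis
    by (metis fract_eval_fract_poly fract_eval.hom_mult fract_eval_const)
qed

lemma degree_coeff_le_degy: "degree (coeff p n) \<le> degy p"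
proof (cases "n \<le> degree p")
  case True
  then show ?thesis unfolding degy_def by (intro Max_ge) auto
qed (simp add: coeff_eq_0)

text \<open>Because the leading coefficient of \<open>d\<close> is free of \<open>y\<close>, both
  normalisations cost only the factor \<open>\<kappa>\<close> in K(x). The power of \<open>c\<close>
  is moved into the numerator over \<open>d\<close>, whose coefficients become single digits at
  \<open>(monic_fract c, l)\<close> by the bound on \<open>degy b\<close>.\<close>

lemma Fract_in_pf_part2:
  fixes b d :: "'k::field_char_0 pxyz" and c :: "'k pxy"
  assumes c: "irreducible c" and d: "irreducible d" "lead_coeff d = [:\<mu>:]"
    and deg: "degree b < degree d" "degy b < degree c" and pos: "l > 0" "m > 0"
  shows "Fract b ([:c:] ^ l * d ^ m) \<in> pf_part2 {(monic_fract c, l)}"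
proof -
  have c0: "c \<noteq> 0" and d0: "d \<noteq> 0" using c d by auto
  define \<kappa> where "\<kappa> = inverse (to_fract (lead_coeff c) ^ l * to_fract \<mu> ^ m)"
  define \<beta> where "\<beta> = smult (inverse (fract_eval (monic_fract c) ^ l)) (map_poly to_fract b)"
  have \<beta>: "fract_eval \<beta> = inverse (const_fract (fract_eval (monic_fract c)) ^ l) * to_fract b"
  proof -
    have "\<beta> = [:inverse (fract_eval (monic_fract c) ^ l):] * map_poly to_fract b"
      by (simp add: \<beta>_def)
    then show ?thesis
      by (simp only: fract_eval.hom_mult fract_eval_const fract_eval_fract_poly
          const_fract.hom_inverse const_fract.hom_power)
  qed
  have eq: "Fract b ([:c:] ^ l * d ^ m)
      = const_fract (const_fract \<kappa>) * (fract_eval \<beta> / fract_eval (monic_fract d) ^ m)"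
  proof -
    have "to_fract [:c:] = const_fract (const_fract (to_fract (lead_coeff c)))
        * const_fract (fract_eval (monic_fract c))"
      unfolding const_fract_to_fract[of c, symmetric] to_fract_eq_monic_fract[OF c0]
      by (simp only: const_fract.hom_mult)
    moreover have "to_fract d = const_fract (const_fract (to_fract \<mu>)) * fract_eval (monic_fract d)"
      using to_fract_eq_monic_fract[OF d0] by (simp only: d(2) const_fract_to_fract)
    moreover have "const_fract (const_fract \<kappa>)
        = inverse (const_fract (const_fract (to_fract (lead_coeff c))) ^ l
            * const_fract (const_fract (to_fract \<mu>)) ^ m)"
      by (simp only: \<kappa>_def const_fract.hom_inverse const_fract.hom_mult const_fract.hom_power)
    ultimately show ?thesis
      unfolding Fract_conv_to_fract \<beta>
      by (simp add: to_fract_hom.hom_power power_mult_distrib field_simps)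
  qed
  have "pf_digit (monic_fract d) m \<beta>"
    using d deg pos irreducible_monic_fract[OF d(1)] lead_coeff_monic_fract[OF d0]
    by (auto simp: pf_digit_def \<beta>_def intro: le_less_trans[OF degree_smult_le])
  moreover have "coeff \<beta> n \<in> pf_part {(monic_fract c, l)}" for n
  proof -
    have "coeff \<beta> n = fract_eval (map_poly to_fract (coeff b n)) / fract_eval (monic_fract c) ^ l"
      by (simp add: \<beta>_def fract_eval_fract_poly field_simps)
    moreover have "pf_digit (monic_fract c) l (map_poly to_fract (coeff b n))"
      using c deg pos irreducible_monic_fract[OF c] lead_coeff_monic_fract[OF c0]
        degree_coeff_le_degy[of b n]
      by (auto simp: pf_digit_def)
    ultimately show ?thesis
      unfolding pf_part_def by (simp add: pf_space_digit)
  qed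
  ultimately show ?thesis
    unfolding eq by (intro pf_part2_scale) (simp add: pf_part2_def pf_space_digit)
qed

text \<open>The value at 0 is attained at all multiples of \<open>s\<close>, which are infinitely
  many in characteristic zero.\<close>

lemma degree_0_of_shift_invariant:
  fixes p :: "'a::{idom,ring_char_0} poly"
  assumes "pcompose p [:s, 1:] = p" "s \<noteq> 0"
  shows "degree p = 0"
proof -
  have step: "poly p (s + x) = poly p x" for x
    using arg_cong[OF assms(1), of "\<lambda>q. poly q x"] by (simp add: poly_pcompose)
  have "poly p (of_nat k * s) = poly p 0" for k
  proof (induction k)
    case (Suc k)
    then show ?case using step[of "of_nat k * s"] by (simp add: distrib_right)
  qed simp
  then have "range (\<lambda>k::nat. of_nat k * s) \<subseteq> {x. poly (p - [:poly p 0:]) x = 0}" by auto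
  moreover have "infinite (range (\<lambda>k::nat. of_nat k * s))"
    using assms(2) by (intro range_inj_infinite) (auto simp: inj_def)
  ultimately have "p - [:poly p 0:] = 0"
    using poly_roots_finite finite_subset by blast
  then show ?thesis by (metis degree_pCons_0 eq_iff_diff_eq_0)
qed

text \<open>A shift in \<open>z\<close> fixes the leading coefficient in \<open>z\<close>, whereas a
  shift in \<open>y\<close> acts on it; that coefficient is therefore invariant under a nonzero
  shift in \<open>y\<close>.\<close>

lemma lead_coeff_of_shift:
  assumes "n > 0" "shy n d = shz k d"
  obtains \<mu> where "lead_coeff d = [:\<mu>:]"
proof -
  have "coeff (shy n d) (degree d) = shy2 n (lead_coeff d)"
    unfolding shy_twist shy2_twist
    by (intro twist_degree_lead_coeff inj_idom_hom_of_isom idom_isom_twist idom_isom_id)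
  moreover have "coeff (shz k d) (degree d) = lead_coeff d"
    unfolding shz_twist
    by (subst twist_degree_lead_coeff(2))
      (intro inj_idom_hom_of_isom idom_isom_twist idom_isom_id, simp add: twist_id_0)
  ultimately have "pcompose (lead_coeff d) [:[:of_int n:], 1:] = lead_coeff d"
    using assms(2) by (simp add: shy2_def)
  then have "degree (lead_coeff d) = 0"
    using assms(1) by (intro degree_0_of_shift_invariant) auto
  then show ?thesis using that by (metis degree_eq_zeroE)
qed

lemma shx_frac_monic_fract: "shx_frac n (monic_fract c) = monic_fract (shx2 n c)"
proof -
  interpret s: inj_idom_hom "shx1 n :: 'a poly \<Rightarrow> _" by (rule inj_idom_hom_shx1)
  interpret F: field_hom "fract_lift (shx1 n) :: 'a poly fract \<Rightarrow> _"
    by (rule field_hom_fract_lift[OF inj_idom_hom_shx1])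
  show ?thesis
    by (rule poly_eqI) (simp add: shx_frac_map_poly monic_fract_def shx2_twist twist_0_right
        coeff_map_poly F.hom_mult F.hom_inverse fract_lift_to_fract inj_idom_hom_shx1)
qed

lemma shy_frac_monic_fract: "shy_frac n (monic_fract c) = monic_fract (shy2 n c)"
proof -
  have deg: "degree (shy2 n c) = degree c" and lc: "coeff (shy2 n c) (degree c) = lead_coeff c"
    unfolding shy2_twist
    by (rule twist_degree_lead_coeff, rule inj_idom_hom_of_isom, rule idom_isom_id)+
  have "map_poly to_fract (shy2 n c) = pcompose (map_poly to_fract c) (pCons (to_fract [:of_int n:]) 1)"
    unfolding shy2_def using map_poly_pcompose_shift[OF to_fract_hom.inj_idom_hom_axioms] by simp
  then show ?thesis
    by (simp add: shy_frac_pcompose monic_fract_def pcompose_smult deg lc)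
qed

text \<open>Normalisation forgets a factor in K(x), which has to be shown to be 1. Primality of
  \<open>q\<close> makes it a polynomial \<open>w\<close>, and comparing degrees in \<open>y\<close>
  puts it in K[x]. As a shift in \<open>x\<close> keeps the degree and leading coefficient of
  \<open>r\<close>, it equals 1.\<close>

lemma monic_fract_shift_free:
  fixes c :: "'k::field_char_0 pxy"
  assumes c: "irreducible c" "degree c > 0"
    and eq: "shx_frac n (monic_fract c) = shy_frac k (monic_fract c)"
  shows "shx2 n c = shy2 k c"
proof -
  define p where "p = shx2 n c"
  define q where "q = shy2 k c"
  define r where "r = lead_coeff c"
  have c0: "c \<noteq> 0" using c by auto
  then have r0: "r \<noteq> 0" by (simp add: r_def)
  have p: "degree p = degree c" "lead_coeff p = shx1 n r"
    unfolding p_def shx2_twist r_def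
    by (simp_all add: twist_degree_lead_coeff inj_idom_hom_shx1)
  have q: "degree q = degree c" "lead_coeff q = r" "irreducible q"
    unfolding q_def shy2_twist r_def
    by (simp_all add: twist_degree_lead_coeff inj_idom_hom_of_isom idom_isom_id irreducible_twist c)
  have s: "degree (shx1 n r) = degree r" "lead_coeff (shx1 n r) = lead_coeff r"
    unfolding shx1_def
    by (simp_all add: twist_degree_lead_coeff inj_idom_hom_of_isom idom_isom_id)
  have s0: "shx1 n r \<noteq> 0" using s(2) r0 by auto
  have "monic_fract p = monic_fract q"
    using eq by (simp add: p_def q_def shx_frac_monic_fract shy_frac_monic_fract)
  then have "smult (to_fract r * to_fract (shx1 n r)) (monic_fract p)
      = smult (to_fract r * to_fract (shx1 n r)) (monic_fract q)" by simp
  then have "map_poly to_fract (smult r p) = map_poly to_fract (smult (shx1 n r) q)"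
    using r0 s0 by (simp add: monic_fract_def p(2) q(2) field_simps)
  then have "smult r p = smult (shx1 n r) q"
    by (simp only: fract_poly_eq_iff)
  then have rel: "[:r:] * p = [:shx1 n r:] * q"
    by simp
  have "prime_elem q" using q(3) by simp
  have "q dvd [:r:] * p" unfolding rel by (rule dvd_triv_right)
  then have "q dvd [:r:] \<or> q dvd p"
    by (rule prime_elem_dvd_multD[OF \<open>prime_elem q\<close>])
  moreover have "\<not> q dvd [:r:]"
    using r0 q(1) c(2) by (auto dest: dvd_imp_degree_le)
  ultimately have "q dvd p" by blast
  then obtain w where w: "p = q * w" ..
  have "p \<noteq> 0" using p(2) s0 by auto
  then have "degree w = 0" using w p(1) q(1) by (auto simp: degree_mult_eq)
  then obtain w0 where w0: "w = [:w0:]" by (metis degree_eq_zeroE)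
  have w00: "w0 \<noteq> 0" using \<open>p \<noteq> 0\<close> w w0 by auto
  have "lead_coeff p = lead_coeff q * w0"
    unfolding w w0 by (simp only: lead_coeff_mult lead_coeff_pCons(2) coeff_pCons_0 degree_pCons_0)
  then have w0r: "shx1 n r = r * w0" using p q by simp
  then have "degree w0 = 0" using s(1) r0 w00 by (simp add: degree_mult_eq)
  then obtain u where u: "w0 = [:u:]" by (metis degree_eq_zeroE)
  have "lead_coeff r = lead_coeff r * u"
    using s(2) unfolding w0r u
    by (simp only: lead_coeff_mult coeff_pCons_0 degree_pCons_0)
  then have "u = 1" using r0 by simp
  then show ?thesis using w w0 u by (simp add: p_def q_def)
qed

section \<open>Normal form of telescopers\<close>

lemma Kx_const_fract:
  assumes "f \<in> Kx"
  obtains u where "f = const_fract (const_fract u)"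
proof -
  obtain p q where "f = Fract [:[:p:]:] [:[:q:]:]" using assms by (auto simp: Kx_def)
  then have "f = const_fract (const_fract (Fract p q))"
    by (simp add: const_fract_def fract_lift_Fract[OF inj_idom_hom_pCons_const])
  then show ?thesis by (rule that)
qed

lemma one_in_Kx: "1 \<in> Kx"
proof -
  have "(1 :: 'a rxyz) = Fract [:[:1:]:] [:[:1:]:]" by (simp add: One_fract_def)
  then show ?thesis unfolding Kx_def by (auto intro!: exI[of _ 1])
qed

text \<open>A telescoper need only have some nonzero coefficient; cutting the sum at the largest
  such index makes the leading one nonzero.\<close>

lemma has_telescoper_nonzero_lead:
  assumes "has_telescoper f"
  obtains N a where "a N \<noteq> 0"
    "yz_summable (\<Sum>i\<le>N. const_fract (const_fract (a i)) * sigx (int i) f)"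
proof -
  obtain N l where l: "\<forall>i\<le>N. l i \<in> Kx" "\<exists>i\<le>N. l i \<noteq> 0"
    "yz_summable (\<Sum>i\<le>N. l i * sigx (int i) f)"
    using assms unfolding has_telescoper_def by blast
  have "\<forall>i. \<exists>u. i \<le> N \<longrightarrow> l i = const_fract (const_fract u)"
    using l(1) Kx_const_fract by metis
  then obtain a where a: "\<And>i. i \<le> N \<Longrightarrow> l i = const_fract (const_fract (a i))" by metis
  define M where "M = Max {i. i \<le> N \<and> l i \<noteq> 0}"
  have fin: "finite {i. i \<le> N \<and> l i \<noteq> 0}" by simp
  have M: "M \<le> N" "l M \<noteq> 0"
    using Max_in[OF fin] l(2) unfolding M_def by auto
  have beyond: "l i = 0" if "i \<le> N" "M < i" for i
  proof (rule ccontr)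
    assume "l i \<noteq> 0"
    then have "i \<le> M" unfolding M_def using that(1) by (intro Max_ge fin) simp
    then show False using that(2) by simp
  qed
  have "(\<Sum>i\<le>N. l i * sigx (int i) f) = (\<Sum>i\<le>M. l i * sigx (int i) f)"
    using M(1) beyond by (intro sum.mono_neutral_right) auto
  also have "\<dots> = (\<Sum>i\<le>M. const_fract (const_fract (a i)) * sigx (int i) f)"
    using M(1) a by (intro sum.cong) auto
  finally show ?thesis
    using that[of a M] l(3) M a[of M] by auto
qed

lemma yz_summable_imp_has_telescoper:
  fixes f :: "'k::field_char_0 rxyz"
  assumes "yz_summable f"
  shows "has_telescoper f"
  unfolding has_telescoper_def
\<comment> \<open>The telescoper is the identity operator, of order 0.\<close>
proof (rule exI[of _ 0], rule exI[of _ "\<lambda>_. 1"], intro conjI)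
  show "\<exists>i\<le>(0::nat). (1 :: 'k rxyz) \<noteq> 0" by auto
qed (use assms one_in_Kx in \<open>simp_all add: sigx_0\<close>)

theorem theorem6p6:
  fixes lam :: nat and d :: "'k::field_char_0 pxyz"
    and I :: nat and ms :: "nat \<Rightarrow> nat"
    and b :: "nat \<Rightarrow> nat \<Rightarrow> 'k pxyz" and c :: "nat \<Rightarrow> 'k pxy"
  assumes lam_pos: "lam > 0"
    and d_irr: "irreducible d"
    and cond_a: "\<exists>m n k. m > (0::int) \<and> shx m d = shy n (shz k d)"
    and cond_b: "\<exists>n1 k1. n1 > (0::int) \<and> shy n1 d = shz k1 d"
    and b_degz: "\<And>i l. i \<in> {1..I} \<Longrightarrow> l \<in> {1..ms i} \<Longrightarrow> b i l \<noteq> 0 \<Longrightarrow> degree (b i l) < degree d"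
    and b_degy: "\<And>i l. i \<in> {1..I} \<Longrightarrow> l \<in> {1..ms i} \<Longrightarrow> b i l \<noteq> 0 \<Longrightarrow> degy (b i l) < degree (c i)"
    and c_irr: "\<And>i. i \<in> {1..I} \<Longrightarrow> irreducible (c i)"
    and c_dist: "inj_on c {1..I}"
    and c_shift: "\<And>i. i \<in> {1..I} \<Longrightarrow> \<not> (\<exists>n' k'. n' > (0::int) \<and> shx2 n' (c i) = shy2 k' (c i))"
  shows "has_telescoper
           (\<Sum>i=1..I. \<Sum>l=1..ms i. Fract (b i l) ([:c i:] ^ l * d ^ lam))
         \<longleftrightarrow> (\<forall>l\<ge>1. yz_summable
               (\<Sum>i=1..I. if l \<le> ms i then Fract (b i l) ([:c i:] ^ l * d ^ lam) else 0))"
proof -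
  define term_of where "term_of = (\<lambda>(i, l). Fract (b i l) ([:c i:] ^ l * d ^ lam))"
  have term_of: "term_of (i, l) = Fract (b i l) ([:c i:] ^ l * d ^ lam)" for i l
    by (simp add: term_of_def)
  \<comment> \<open>Zero numerators contribute nothing and are dropped, since the degree bounds are
    assumed for nonzero numerators only.\<close>
  define T where "T = {(i, l). i \<in> {1..I} \<and> l \<in> {1..ms i} \<and> b i l \<noteq> 0}"
  define \<omega> where "\<omega> = (\<lambda>(i, l::nat). (monic_fract (c i), l))"
  have T_sub: "T \<subseteq> (SIGMA i:{1..I}. {1..ms i})" by (auto simp: T_def)
  then have fin: "finite T" by (rule finite_subset) simp
  obtain \<mu> where \<mu>: "lead_coeff d = [:\<mu>:]"
    using cond_b lead_coeff_of_shift by metis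
  have mem: "term_of t \<in> pf_part2 {\<omega> t}" if "t \<in> T" for t
  proof -
    obtain i l where "t = (i, l)" "i \<in> {1..I}" "l \<in> {1..ms i}" "b i l \<noteq> 0"
      using \<open>t \<in> T\<close> by (auto simp: T_def)
    then show ?thesis
      using Fract_in_pf_part2[OF c_irr d_irr \<mu> b_degz b_degy _ lam_pos]
      by (simp add: term_of_def \<omega>_def)
  qed
  have free: "shx_frac n (fst (\<omega> t)) \<noteq> shy_frac k (fst (\<omega> t))" if "t \<in> T" "n > 0" for t n k
  proof
    obtain i l where t: "t = (i, l)" "i \<in> {1..I}" "l \<in> {1..ms i}" "b i l \<noteq> 0"
      using \<open>t \<in> T\<close> by (auto simp: T_def)
    assume "shx_frac n (fst (\<omega> t)) = shy_frac k (fst (\<omega> t))"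
    \<comment> \<open>The bound on \<open>degy (b i l)\<close> forces \<open>c i\<close> to have
      positive degree in \<open>y\<close>, as the descent from monic polynomials requires.\<close>
    then have "shx2 n (c i) = shy2 k (c i)"
      using b_degy[OF t(2-4)] by (intro monic_fract_shift_free c_irr t) (auto simp: \<omega>_def t)
    then show False using c_shift[OF t(2)] \<open>n > 0\<close> by blast
  qed
  have total: "(\<Sum>i=1..I. \<Sum>l=1..ms i. Fract (b i l) ([:c i:] ^ l * d ^ lam)) = (\<Sum>t\<in>T. term_of t)"
  proof -
    have "(\<Sum>i=1..I. \<Sum>l=1..ms i. Fract (b i l) ([:c i:] ^ l * d ^ lam))
        = (\<Sum>t\<in>(SIGMA i:{1..I}. {1..ms i}). term_of t)"
      by (simp add: sum.Sigma term_of_def)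
    also have "\<dots> = (\<Sum>t\<in>T. term_of t)"
      by (rule sum.mono_neutral_right[OF _ T_sub])
        (auto simp: T_def term_of_def Fract_conv_to_fract)
    finally show ?thesis .
  qed
  have layer: "(\<Sum>i=1..I. if l \<le> ms i then Fract (b i l) ([:c i:] ^ l * d ^ lam) else 0)
      = (\<Sum>t | t \<in> T \<and> snd t = l. term_of t)" if "l \<ge> 1" for l
  proof -
    have "{t. t \<in> T \<and> snd t = l} = (\<lambda>i. (i, l)) ` {i \<in> {1..I}. l \<le> ms i \<and> b i l \<noteq> 0}"
      using that by (auto simp: T_def)
    then have "(\<Sum>t | t \<in> T \<and> snd t = l. term_of t)
        = (\<Sum>i | i \<in> {1..I} \<and> l \<le> ms i \<and> b i l \<noteq> 0. term_of (i, l))"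
      by (simp add: sum.reindex inj_on_def)
    also have "\<dots> = (\<Sum>i=1..I. if l \<le> ms i then term_of (i, l) else 0)"
      by (rule sum.mono_neutral_cong_left) (auto simp: term_of_def Fract_conv_to_fract)
    finally have eq: "(\<Sum>t | t \<in> T \<and> snd t = l. term_of t) = \<dots>" .
    show ?thesis unfolding eq term_of ..
  qed
  have telescoper_summable: "yz_summable (\<Sum>t\<in>T. term_of t)"
    if tel: "has_telescoper (\<Sum>t\<in>T. term_of t)"
  proof -
    obtain N a where a: "a N \<noteq> 0"
      "yz_summable (\<Sum>i\<le>N. const_fract (const_fract (a i)) * sigx (int i) (\<Sum>t\<in>T. term_of t))"
      using has_telescoper_nonzero_lead[OF tel] by blast
    show ?thesis
      by (rule telescoper_imp_yz_summable[where \<omega> = \<omega> and a = a and N = N])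
        (fact fin, fact mem, fact free, fact a(1), fact a(2))
  qed
  have layer_summable: "yz_summable (\<Sum>t | t \<in> T \<and> snd t = l. term_of t)"
    if sum: "yz_summable (\<Sum>t\<in>T. term_of t)" for l
  \<comment> \<open>Shifts change \<open>c\<close> but not the exponent, so the places of exponent
    \<open>l\<close> form an invariant set.\<close>
  proof (rule yz_summable_pf_part2[where S = "{(e, m). m = l}"
        and g = "\<Sum>t | t \<in> T \<and> snd t \<noteq> l. term_of t"])
    show "(\<Sum>t | t \<in> T \<and> snd t = l. term_of t) \<in> pf_part2 {(e, m). m = l}"
      by (intro pf_part2_sum pf_part2_mono[OF mem]) (auto simp: \<omega>_def)
    show "(\<Sum>t | t \<in> T \<and> snd t \<noteq> l. term_of t) \<in> pf_part2 (- {(e, m). m = l})"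
      by (intro pf_part2_sum pf_part2_mono[OF mem]) (auto simp: \<omega>_def)
    have "(\<Sum>t\<in>T. term_of t) = (\<Sum>t | t \<in> T \<and> snd t = l. term_of t)
        + (\<Sum>t | t \<in> T \<and> snd t \<noteq> l. term_of t)"
    proof -
      have "(\<Sum>t\<in>T. term_of t) = sum term_of ({t. t \<in> T \<and> snd t = l} \<union> {t. t \<in> T \<and> snd t \<noteq> l})"
        by (rule arg_cong[where f = "sum term_of"]) auto
      also have "\<dots> = (\<Sum>t | t \<in> T \<and> snd t = l. term_of t) + (\<Sum>t | t \<in> T \<and> snd t \<noteq> l. term_of t)"
        using fin by (intro sum.union_disjoint) auto
      finally show ?thesis .
    qed
    then show "yz_summable ((\<Sum>t | t \<in> T \<and> snd t = l. term_of t)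
        + (\<Sum>t | t \<in> T \<and> snd t \<noteq> l. term_of t))"
      using sum by simp
  qed simp
  have layers_telescoper: "has_telescoper (\<Sum>t\<in>T. term_of t)"
    if *: "\<And>l. l \<ge> 1 \<Longrightarrow> yz_summable (\<Sum>t | t \<in> T \<and> snd t = l. term_of t)"
  proof (rule yz_summable_imp_has_telescoper)
    \<comment> \<open>Every exponent occurring in \<open>T\<close> is at least 1, so the finitely
      many layers are all summable and add up to the whole sum.\<close>
    have "yz_summable (\<Sum>l\<in>snd ` T. \<Sum>t | t \<in> T \<and> snd t = l. term_of t)"
      by (intro yz_summable_sum *) (auto simp: T_def)
    then show "yz_summable (\<Sum>t\<in>T. term_of t)"
      by (simp only: sum.group[OF fin finite_imageI[OF fin] order_refl])
  qed
  show ?thesis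
    unfolding total
  proof (intro iffI allI impI)
    fix l :: nat
    assume "has_telescoper (\<Sum>t\<in>T. term_of t)" and l: "l \<ge> 1"
    then show "yz_summable
        (\<Sum>i=1..I. if l \<le> ms i then Fract (b i l) ([:c i:] ^ l * d ^ lam) else 0)"
      unfolding layer[OF l] by (intro layer_summable telescoper_summable)
  next
    assume *: "\<forall>l\<ge>1. yz_summable
        (\<Sum>i=1..I. if l \<le> ms i then Fract (b i l) ([:c i:] ^ l * d ^ lam) else 0)"
    show "has_telescoper (\<Sum>t\<in>T. term_of t)"
    proof (rule layers_telescoper)
      fix l :: nat
      assume l: "l \<ge> 1"
      show "yz_summable (\<Sum>t | t \<in> T \<and> snd t = l. term_of t)"
        unfolding layer[OF l, symmetric] using * l by blast
    qed
  qed
qed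

end
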